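(* Let $\mathcal Z,\mathcal Q,\mathcal Y,\mathcal V$ be separable Hilbert spaces. Let $A:D(A)\subset\mathcal Z\to\mathcal Z$ be the infinitesimal generator of a strongly continuous semigroup on $\mathcal Z$, and let $Q\in\mathcal L(\mathcal Z,\mathcal Q)$, $C\in\mathcal L(\mathcal Z,\mathcal Y)$ and $S\in\mathcal L(\mathcal V,\mathcal Y)$, with $SS^*$ coercive. Consider the observation system, for $t\ge 0$, $$\frac{dz(t)}{dt}=Az(t)+w(t),\quad z(0)=0,\qquad q(t)=Qz(t),\qquad y(t)=Cz(t)+Sv(t),$$ with process disturbance $w\in L_2([0,\infty);\mathcal Z)$ and measurement noise $v\in L_2([0,\infty);\mathcal V)$, and the class of observers $$\frac{d\nu(t)}{dt}=A\nu(t)+L\left(C\nu(t)-y(t)\right),\qquad \nu(0)=0,$$ where $L\in\mathcal L(\mathcal Y,\mathcal Z)$. If $A$ is self-adjoint and strictly negative, then the estimation error $$\sup_{\|[w^*\ v^*]\|_2=1}\ \|Qz-Q\nu\|_2 ,$$ considered as a function of $L\in\mathcal L(\mathcal Y,\mathcal Z)$, is minimized by $$L_{\text{opt}}=A^{-1}C^*(SS^* )^{-1},$$ and the minimal estimation error is $$\left\|Q\left(A^2+C^*(SS^* )^{-1}C\right)^{-1}Q^*\right\|^{\frac12}.$$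
   Context: $\mathcal L(\mathcal X,\mathcal Y)$ denotes the bounded linear operators from $\mathcal X$ to $\mathcal Y$; $T^*$ denotes the adjoint of $T$. A self-adjoint operator $A$ on a Hilbert space $\mathcal Z$ is strictly positive (coercive) if there is $m>0$ with $\langle Az,z\rangle\ge m\|z\|^2$ for all $z\in D(A)$; $A$ is strictly negative if $-A$ is strictly positive. $\|\cdot\|_2$ denotes the norm of $L_2[0,\infty)$ with values in the relevant Hilbert space, and $\|[w^*\ v^*]\|_2^2=\|w\|_2^2+\|v\|_2^2$; the supremum is over all $(w,v)\in L_2([0,\infty);\mathcal Z)\times L_2([0,\infty);\mathcal V)$ of norm $1$. The value $+\infty$ is allowed for $\|Qz-Q\nu\|_2$ and for the supremum. Solutions of the differential equations are understood in the mild (variation of constants) sense. The operator $A^2+C^*(SS^* )^{-1}C$ has domain $D(A^2)$. *)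

theory Defs
  imports "HOL-Analysis.Analysis"
begin

(* A normed field over the reals with multiplicative norm is \<real> or \<complex> (Gelfand-Mazur), so
   'k::real_normed_field stands for the scalar field of the Hilbert spaces.  Given the two
   conditions below, the inner product \<bullet> of the type is the real part of a 'k-valued inner product
   inducing the same norm (for 'k = complex it is  x \<bullet> y + i (x \<bullet> sc i y),  conjugate-linear in
   the second argument), and every real or complex Hilbert space arises in this way.
   For 'k-linear operators on 'k-invariant domains, adjoints and self-adjointness with respect
   to \<bullet> and with respect to the 'k-valued inner product coincide; moreover <Az,z> is real when A
   is self-adjoint, so that it equals (A z) \<bullet> z. *)
definition hilbert_scalars ::
    "('k::real_normed_field \<Rightarrow> 'x::{real_inner,banach} \<Rightarrow> 'x) \<Rightarrow> bool" where
  "hilbert_scalars sc \<longleftrightarrow>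
     vector_space sc \<and>
     (\<forall>r x. sc (of_real r) x = r *\<^sub>R x) \<and>
     (\<forall>a x. norm (sc a x) = norm a * norm x)"

definition bounded_ops ::
    "('k::real_normed_field \<Rightarrow> 'x::{real_inner,banach} \<Rightarrow> 'x) \<Rightarrow>
     ('k \<Rightarrow> 'y::{real_inner,banach} \<Rightarrow> 'y) \<Rightarrow> ('x \<Rightarrow> 'y) set" where
  "bounded_ops scX scY = {B. bounded_linear B \<and> (\<forall>a x. B (scX a x) = scY a (B x))}"

definition c0_semigroup ::
    "('k::real_normed_field \<Rightarrow> 'z::{real_inner,banach} \<Rightarrow> 'z) \<Rightarrow> (real \<Rightarrow> 'z \<Rightarrow> 'z) \<Rightarrow> bool" where
  "c0_semigroup sc T \<longleftrightarrow>
     (\<forall>t\<ge>0. T t \<in> bounded_ops sc sc) \<and>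
     T 0 = id \<and>
     (\<forall>s\<ge>0. \<forall>t\<ge>0. T (s + t) = T s \<circ> T t) \<and>
     (\<forall>z. ((\<lambda>t. T t z) \<longlongrightarrow> z) (at_right 0))"

(* An unbounded operator is a pair of a domain D and a total function A; only the values of A on D
   are meaningful. *)
definition infinitesimal_generator ::
    "(real \<Rightarrow> 'z::{real_inner,banach} \<Rightarrow> 'z) \<Rightarrow> 'z set \<Rightarrow> ('z \<Rightarrow> 'z) \<Rightarrow> bool" where
  "infinitesimal_generator T D A \<longleftrightarrow>
     D = {z. \<exists>y. ((\<lambda>h. (T h z - z) /\<^sub>R h) \<longlongrightarrow> y) (at_right 0)} \<and>
     (\<forall>z\<in>D. ((\<lambda>h. (T h z - z) /\<^sub>R h) \<longlongrightarrow> A z) (at_right 0))"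

(* The second conjunct says that the graphs of the adjoint of A and of A are equal,
   including their domains. *)
definition self_adjoint :: "'z::{real_inner,banach} set \<Rightarrow> ('z \<Rightarrow> 'z) \<Rightarrow> bool" where
  "self_adjoint D A \<longleftrightarrow>
     closure D = UNIV \<and>
     (\<forall>y y'. (\<forall>x\<in>D. A x \<bullet> y = x \<bullet> y') \<longleftrightarrow> y \<in> D \<and> y' = A y)"

definition strictly_positive :: "'z::{real_inner,banach} set \<Rightarrow> ('z \<Rightarrow> 'z) \<Rightarrow> bool" where
  "strictly_positive D A \<longleftrightarrow>
     self_adjoint D A \<and> (\<exists>m>0. \<forall>z\<in>D. A z \<bullet> z \<ge> m * (norm z)\<^sup>2)"

definition strictly_negative :: "'z::{real_inner,banach} set \<Rightarrow> ('z \<Rightarrow> 'z) \<Rightarrow> bool" where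
  "strictly_negative D A \<longleftrightarrow> strictly_positive D (\<lambda>z. - A z)"

(* Norm of L_2[0,\<infinity>), with value \<infinity> for functions that are not square integrable. *)
definition L2_norm :: "(real \<Rightarrow> 'x::real_normed_vector) \<Rightarrow> ennreal" where
  "L2_norm f =
     (let I = (\<integral>\<^sup>+ t\<in>{0..}. ennreal ((norm (f t))\<^sup>2) \<partial>lborel)
      in if I = \<infinity> then \<infinity> else ennreal (sqrt (enn2real I)))"

definition L2 :: "(real \<Rightarrow> 'x::{real_inner,banach,second_countable_topology}) set" where
  "L2 = {f. set_borel_measurable lborel {0..} f \<and> L2_norm f < \<infinity>}"

(* Mild solution of  dx/dt = A x + f,  x(0) = x0,  where A generates T.  The function f may
   itself be built from x. *)
definition mild_solution ::
    "(real \<Rightarrow> 'z::{real_inner,banach,second_countable_topology} \<Rightarrow> 'z) \<Rightarrow> 'z \<Rightarrow>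
     (real \<Rightarrow> 'z) \<Rightarrow> (real \<Rightarrow> 'z) \<Rightarrow> bool" where
  "mild_solution T x0 f x \<longleftrightarrow>
     continuous_on {0..} x \<and>
     (\<forall>t\<ge>0. set_integrable lborel {0..t} (\<lambda>s. T (t - s) (f s)) \<and>
            x t = T t x0 + (LINT s:{0..t}|lborel. T (t - s) (f s)))"

(* z is the state of the observed system and \<nu> that of the observer with gain L. *)
definition estimation_error ::
    "(real \<Rightarrow> 'z::{real_inner,banach,second_countable_topology} \<Rightarrow> 'z) \<Rightarrow>
     ('z \<Rightarrow> 'q::{real_inner,banach,second_countable_topology}) \<Rightarrow>
     ('z \<Rightarrow> 'y::{real_inner,banach,second_countable_topology}) \<Rightarrow>
     ('v::{real_inner,banach,second_countable_topology} \<Rightarrow> 'y) \<Rightarrow>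
     ('y \<Rightarrow> 'z) \<Rightarrow> ennreal" where
  "estimation_error T Q C S L =
     Sup {L2_norm (\<lambda>t. Q (z t) - Q (\<nu> t)) | w v z y \<nu>.
            w \<in> L2 \<and> v \<in> L2 \<and> (L2_norm w)\<^sup>2 + (L2_norm v)\<^sup>2 = 1 \<and>
            mild_solution T 0 w z \<and>
            y = (\<lambda>t. C (z t) + S (v t)) \<and>
            mild_solution T 0 (\<lambda>t. L (C (\<nu> t) - y t)) \<nu>}"

end

theory Submission
  imports Defs
begin

text \<open>
Write \<open>P = (S S*)\<inverse>\<close>, \<open>W = A\<^sup>2 + C* P C\<close>, \<open>G = Q W\<inverse> Q*\<close>, and let
\<open>a x = \<parallel>A x\<parallel>\<^sup>2 + C x \<bullet> P (C x)\<close> be the quadratic form of \<open>W\<close> on the domain of \<open>A\<close>.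
The operators \<open>A\<close>, \<open>S S*\<close> and \<open>W\<close> are inverted with one tool: a coercive self-adjoint
operator is bijective with bounded inverse (\<open>coercive_self_adjoint_inverse\<close>,
\<open>normal_operator_inverse\<close>).

Lower bound, for every gain (\<open>estimation_error_ge\<close>). For \<open>x\<close> in the domain of \<open>A\<close> and a scalar
function \<open>\<phi>\<close> of compact support with \<open>\<phi> 0 = 0\<close>, the disturbances \<open>w = \<phi>' x - \<phi> A x\<close> and
\<open>v = - \<phi> S* P C x\<close> produce the state \<open>z = \<phi> x\<close> and the measurement \<open>y = 0\<close>. The observer
therefore remains at \<open>0\<close>, and the error is \<open>\<phi> Q x\<close>. If \<open>\<phi>\<close> varies slowly, the squared norm
of \<open>(w, v)\<close> is nearly \<open>\<parallel>\<phi>\<parallel>\<^sup>2 a x\<close>. Hence \<open>\<parallel>Q x\<parallel>\<^sup>2 \<le> E\<^sup>2 a x\<close> for the estimation error \<open>E\<close>,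
and the choice \<open>x = W\<inverse> Q* h\<close>, for which \<open>Q x = G h\<close> and \<open>a x = G h \<bullet> h\<close>, gives
\<open>\<parallel>G h\<parallel> \<le> E\<^sup>2 \<parallel>h\<parallel>\<close>.

Upper bound, for the gain \<open>A\<inverse> C* P\<close> (\<open>estimation_error_le\<close>). The error \<open>e\<close> of the observer
formally satisfies \<open>A e' = W e + A w + C* P S v\<close>. The inner product with \<open>e\<close>, integrated in time, is
an energy balance for \<open>A e \<bullet> e \<le> 0\<close>; it yields that the integral of \<open>a e\<close> is at most
\<open>\<parallel>w\<parallel>\<^sup>2 + \<parallel>v\<parallel>\<^sup>2\<close>. Moreover \<open>\<parallel>Q x\<parallel>\<^sup>2 \<le> \<parallel>G\<parallel> a x\<close> (\<open>output_bound_by_form\<close>). A mild solution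
need not take values in the domain of \<open>A\<close>, so the balance is established for \<open>g = J (J e)\<close> with
the resolvent \<open>J = (1 - \<epsilon> A)\<inverse>\<close>, and \<open>\<epsilon>\<close> is sent to \<open>0\<close> in the end (\<open>filter_bound\<close>). The
derivative of the energy is replaced by two applications of Fubini's theorem
(\<open>mild_solution_integrated\<close>, \<open>quadratic_form_indefinite_integral\<close>).
\<close>

section \<open>Adjoints and self-adjoint operators on Hilbert spaces\<close>

text \<open>The vector is \<open>x - l\<close>, where \<open>x\<close> lies outside \<open>M\<close> and \<open>l\<close> is the point of \<open>M\<close>
closest to \<open>x\<close>; a minimizing sequence converges to it by the parallelogram law.\<close>

lemma orthogonal_to_closed_subspace_exists:
  fixes M :: "'a::{real_inner,banach} set"
  assumes sub: "subspace M" and cl: "closed M" and ne: "M \<noteq> UNIV"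
  obtains u where "u \<noteq> 0" "\<And>y. y \<in> M \<Longrightarrow> y \<bullet> u = 0"
proof -
  obtain x where x: "x \<notin> M" using ne by auto
  define d where "d = infdist x M"
  have M0: "0 \<in> M" "M \<noteq> {}" using sub subspace_0 by auto
  have d0: "d \<ge> 0" unfolding d_def by (rule infdist_nonneg)
  have dle: "d \<le> norm (x - y)" if "y \<in> M" for y
    unfolding d_def using infdist_le[OF that, of x] by (simp add: dist_norm)
  have "\<exists>y\<in>M. norm (x - y) < d + 1 / Suc n" for n
  proof (rule ccontr)
    assume "\<not> ?thesis"
    then have "d + 1 / Suc n \<le> d"
      unfolding d_def infdist_notempty[OF M0(2)] using M0(2)
      by (intro cINF_greatest) (auto simp: dist_norm not_less)
    then show False by simp
  qed
  then obtain m where m: "\<And>n. m n \<in> M" "\<And>n. norm (x - m n) < d + 1 / Suc n" by metis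
  have sq: "(norm (x - m n))\<^sup>2 \<le> d\<^sup>2 + (2 * d + 1) * (1 / Suc n)" for n
  proof -
    have "(norm (x - m n))\<^sup>2 \<le> (d + 1 / Suc n)\<^sup>2"
      using m(2)[of n] by (intro power_mono) auto
    also have "\<dots> = d\<^sup>2 + 2 * d * (1 / Suc n) + (1 / Suc n) * (1 / Suc n)"
      by (simp add: power2_eq_square algebra_simps)
    also have "(1 / Suc n) * (1 / Suc n) \<le> 1 * (1 / real (Suc n))"
      by (intro mult_right_mono) auto
    finally show ?thesis by (simp add: algebra_simps)
  qed
  have para: "(norm (m n - m k))\<^sup>2 \<le> 2 * (2 * d + 1) * (1 / Suc n + 1 / Suc k)" for n k
  proof -
    have "(1/2) *\<^sub>R (m n + m k) \<in> M"
      using m(1) sub by (intro subspace_scale subspace_add) auto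
    then have "d\<^sup>2 \<le> (norm (x - (1/2) *\<^sub>R (m n + m k)))\<^sup>2"
      using dle d0 by (intro power_mono) auto
    moreover have "(norm (m n - m k))\<^sup>2 = 2 * (norm (x - m n))\<^sup>2 + 2 * (norm (x - m k))\<^sup>2
        - 4 * (norm (x - (1/2) *\<^sub>R (m n + m k)))\<^sup>2"
      unfolding power2_norm_eq_inner
      by (simp add: inner_diff inner_add inner_commute algebra_simps)
    ultimately have "(norm (m n - m k))\<^sup>2 \<le> 2 * (norm (x - m n))\<^sup>2 + 2 * (norm (x - m k))\<^sup>2 - 4 * d\<^sup>2"
      by linarith
    moreover have "2 * (2 * d + 1) * (1 / Suc n + 1 / Suc k)
        = 2 * ((2 * d + 1) * (1 / Suc n)) + 2 * ((2 * d + 1) * (1 / Suc k))" by (simp add: algebra_simps)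
    ultimately show ?thesis using sq[of n] sq[of k] by linarith
  qed
  have "Cauchy m"
  proof (rule metric_CauchyI)
    fix e :: real assume e: "e > 0"
    let ?c = "2 * (2 * d + 1)"
    have c: "?c > 0" using d0 by simp
    obtain N where N: "1 / Suc N < e\<^sup>2 / (2 * ?c)"
      using reals_Archimedean[of "e\<^sup>2 / (2 * ?c)"] e c by (auto simp: inverse_eq_divide)
    have "dist (m n) (m k) < e" if "n \<ge> N" "k \<ge> N" for n k
    proof -
      have "1 / Suc n \<le> 1 / Suc N" "1 / Suc k \<le> 1 / Suc N"
        using that by (auto simp: frac_le)
      then have "1 / Suc n + 1 / Suc k \<le> 2 * (1 / Suc N)" by linarith
      also have "\<dots> < 2 * (e\<^sup>2 / (2 * ?c))" using N by (intro mult_strict_left_mono) auto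
      also have "\<dots> = e\<^sup>2 / ?c" by (subst times_divide_eq_right, subst mult_divide_mult_cancel_left) simp_all
      finally have "1 / Suc n + 1 / Suc k < e\<^sup>2 / ?c" .
      then have "?c * (1 / Suc n + 1 / Suc k) < ?c * (e\<^sup>2 / ?c)"
        using c by (intro mult_strict_left_mono) auto
      also have "\<dots> = e\<^sup>2" using c by simp
      finally have "(norm (m n - m k))\<^sup>2 < e\<^sup>2" using para[of n k] by simp
      then show ?thesis using e by (simp add: dist_norm power_less_imp_less_base)
    qed
    then show "\<exists>N. \<forall>n\<ge>N. \<forall>k\<ge>N. dist (m n) (m k) < e" by blast
  qed
  then obtain l where l: "m \<longlonglongrightarrow> l" using Cauchy_convergent_iff convergent_def by blast
  have lM: "l \<in> M" using closed_sequentially[OF cl] m(1) l by blast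
  define u where "u = x - l"
  have "(\<lambda>n. norm (x - m n)) \<longlonglongrightarrow> norm u" unfolding u_def by (intro tendsto_intros l)
  moreover have "(\<lambda>n. d + 1 / Suc n) \<longlonglongrightarrow> d + 0"
    by (intro tendsto_add tendsto_const LIMSEQ_inverse_real_of_nat[unfolded inverse_eq_divide])
  ultimately have ud: "norm u \<le> d" using m(2) by (intro LIMSEQ_le) (auto intro: less_imp_le)
  show thesis
  proof
    show "u \<noteq> 0" using x lM unfolding u_def by auto
    fix y assume y: "y \<in> M"
    show "y \<bullet> u = 0"
    proof (cases "y = 0")
      case False
      define s where "s = (u \<bullet> y) / (y \<bullet> y)"
      have "l + s *\<^sub>R y \<in> M" using y lM sub by (intro subspace_add subspace_scale) auto
      then have "norm u \<le> norm (u - s *\<^sub>R y)"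
        using dle[of "l + s *\<^sub>R y"] ud unfolding u_def by (simp add: algebra_simps)
      then have "(norm u)\<^sup>2 \<le> (norm (u - s *\<^sub>R y))\<^sup>2" by (intro power_mono) auto
      also have "\<dots> = (norm u)\<^sup>2 - 2 * s * (u \<bullet> y) + s * s * (y \<bullet> y)"
        unfolding power2_norm_eq_inner by (simp add: inner_diff inner_commute algebra_simps)
      also have "\<dots> = (norm u)\<^sup>2 - (u \<bullet> y)\<^sup>2 / (y \<bullet> y)"
        using False unfolding s_def by (simp add: power2_eq_square field_simps)
      finally have "(u \<bullet> y)\<^sup>2 / (y \<bullet> y) \<le> 0" by simp
      moreover have "y \<bullet> y > 0" using False by simp
      ultimately have "(u \<bullet> y)\<^sup>2 \<le> 0" by (simp add: divide_le_0_iff)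
      then show ?thesis by (simp add: inner_commute)
    qed simp
  qed
qed

lemma riesz_representation:
  fixes f :: "'a::{real_inner,banach} \<Rightarrow> real"
  assumes f: "bounded_linear f"
  obtains u where "\<And>x. f x = x \<bullet> u"
proof (cases "\<forall>x. f x = 0")
  case True
  then show ?thesis using that[of 0] by simp
next
  case False
  interpret bounded_linear f by fact
  let ?M = "{x. f x = 0}"
  have "subspace ?M" by (auto simp: subspace_def add scale zero)
  moreover have "closed ?M"
    by (intro closed_Collect_eq continuous_intros linear_continuous_on f)
  moreover have "?M \<noteq> UNIV" using False by auto
  ultimately obtain u where u: "u \<noteq> 0" "\<And>y. f y = 0 \<Longrightarrow> y \<bullet> u = 0"
    using orthogonal_to_closed_subspace_exists[of ?M] by auto
  have fu: "f u \<noteq> 0" using u(2)[of u] u(1) by auto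
  show ?thesis
  proof (rule that)
    fix x
    have "(x - (f x / f u) *\<^sub>R u) \<bullet> u = 0"
      by (rule u(2)) (use fu in \<open>simp add: diff scale\<close>)
    then have "x \<bullet> u = f x / f u * (u \<bullet> u)" by (simp add: inner_diff)
    then show "f x = x \<bullet> ((f u / (u \<bullet> u)) *\<^sub>R u)"
      using fu u(1) by simp
  qed
qed

text \<open>The constant \<open>adjoint\<close> is a choice of an operator with the adjoint property; by the
representation theorem this property holds for every bounded operator on a Hilbert space.\<close>

lemma adjoint_inner:
  fixes f :: "'a::{real_inner,banach} \<Rightarrow> 'b::real_inner"
  assumes f: "bounded_linear f"
  shows "f x \<bullet> y = x \<bullet> adjoint f y"
proof -
  have "\<exists>u. \<forall>x. f x \<bullet> y = x \<bullet> u" for y :: 'b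
  proof -
    have "bounded_linear (\<lambda>x. f x \<bullet> y)" by (rule bounded_linear_compose[OF bounded_linear_inner_left f])
    then obtain u where u: "\<And>x. f x \<bullet> y = x \<bullet> u" by (rule riesz_representation) (rule that)
    show ?thesis by (rule exI[of _ u]) (simp add: u)
  qed
  then have "\<forall>y. \<exists>u. \<forall>x. f x \<bullet> y = x \<bullet> u" by blast
  from choice[OF this] have "\<exists>f'. \<forall>x y. f x \<bullet> y = x \<bullet> f' y" by blast
  from someI_ex[OF this] show ?thesis unfolding adjoint_def by blast
qed

lemma bounded_linear_adjoint:
  fixes f :: "'a::{real_inner,banach} \<Rightarrow> 'b::real_inner"
  assumes f: "bounded_linear f"
  shows "bounded_linear (adjoint f)"
proof -
  note adj = adjoint_inner[OF f, symmetric]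
  obtain K where K0: "K \<ge> 0" and K: "\<And>x. norm (f x) \<le> norm x * K"
    using bounded_linear.nonneg_bounded[OF f] by blast
  show ?thesis
  proof (rule bounded_linear_intro)
    show "adjoint f (x + y) = adjoint f x + adjoint f y" for x y
      by (subst vector_eq_ldot[symmetric]) (simp add: adj inner_add_right)
    show "adjoint f (r *\<^sub>R x) = r *\<^sub>R adjoint f x" for r x
      by (subst vector_eq_ldot[symmetric]) (simp add: adj)
    show "norm (adjoint f x) \<le> norm x * K" for x
    proof (cases "adjoint f x = 0")
      case True
      then show ?thesis using K0 by simp
    next
      case False
      have "norm (adjoint f x) * norm (adjoint f x) = f (adjoint f x) \<bullet> x"
        using adj[of "adjoint f x" x] by (simp add: power2_norm_eq_inner[symmetric] power2_eq_square)
      also have "\<dots> \<le> norm (adjoint f x) * K * norm x"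
        by (rule order_trans[OF norm_cauchy_schwarz mult_right_mono[OF K]]) simp
      finally show ?thesis using False by (simp add: mult.commute)
    qed
  qed
qed

text \<open>The definition of self-adjointness contains no algebraic assumption on the domain or on
the operator, and no closedness: all of these follow from the maximality of the graph.\<close>

lemma self_adjointD:
  assumes "self_adjoint D A"
  shows self_adjoint_dense: "closure D = UNIV"
    and self_adjoint_sym: "x \<in> D \<Longrightarrow> y \<in> D \<Longrightarrow> A x \<bullet> y = x \<bullet> A y"
    and self_adjoint_domainI: "(\<And>x. x \<in> D \<Longrightarrow> A x \<bullet> y = x \<bullet> y') \<Longrightarrow> y \<in> D"
    and self_adjoint_valueI: "(\<And>x. x \<in> D \<Longrightarrow> A x \<bullet> y = x \<bullet> y') \<Longrightarrow> A y = y'"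
proof -
  have adj: "(\<forall>x\<in>D. A x \<bullet> y = x \<bullet> y') \<longleftrightarrow> y \<in> D \<and> y' = A y" for y y'
    using assms unfolding self_adjoint_def by (elim conjE allE)
  show "closure D = UNIV" using assms unfolding self_adjoint_def by (elim conjE)
  show "x \<in> D \<Longrightarrow> y \<in> D \<Longrightarrow> A x \<bullet> y = x \<bullet> A y" using adj[of y "A y"] by simp
  show "(\<And>x. x \<in> D \<Longrightarrow> A x \<bullet> y = x \<bullet> y') \<Longrightarrow> y \<in> D"
    "(\<And>x. x \<in> D \<Longrightarrow> A x \<bullet> y = x \<bullet> y') \<Longrightarrow> A y = y'" using adj[of y y'] by simp_all
qed

lemma self_adjoint_linear:
  assumes sa: "self_adjoint D A"
  shows "subspace D"
    and self_adjoint_add: "x \<in> D \<Longrightarrow> y \<in> D \<Longrightarrow> A (x + y) = A x + A y"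
    and self_adjoint_scaleR: "x \<in> D \<Longrightarrow> A (r *\<^sub>R x) = r *\<^sub>R A x"
proof -
  note sym = self_adjoint_sym[OF sa]
  have add: "A z \<bullet> (x + y) = z \<bullet> (A x + A y)" if "z \<in> D" "x \<in> D" "y \<in> D" for x y z
    using that by (simp add: inner_add_right sym)
  have sc: "A z \<bullet> (r *\<^sub>R x) = z \<bullet> (r *\<^sub>R A x)" if "z \<in> D" "x \<in> D" for x z r
    using that by (simp add: sym)
  have "0 \<in> D" by (rule self_adjoint_domainI[OF sa, of 0 0]) simp
  then show "subspace D" unfolding subspace_def
    using self_adjoint_domainI[OF sa add] self_adjoint_domainI[OF sa sc] by blast
  show "x \<in> D \<Longrightarrow> y \<in> D \<Longrightarrow> A (x + y) = A x + A y"
    using self_adjoint_valueI[OF sa add] by blast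
  show "x \<in> D \<Longrightarrow> A (r *\<^sub>R x) = r *\<^sub>R A x" using self_adjoint_valueI[OF sa sc] by blast
qed

lemma self_adjoint_closed:
  assumes sa: "self_adjoint D A" and x: "\<And>n. x n \<in> D" "x \<longlonglongrightarrow> z" "(\<lambda>n. A (x n)) \<longlonglongrightarrow> y"
  shows "z \<in> D" "A z = y"
proof -
  have "A w \<bullet> z = w \<bullet> y" if w: "w \<in> D" for w
  proof (rule LIMSEQ_unique)
    show "(\<lambda>n. A w \<bullet> x n) \<longlonglongrightarrow> A w \<bullet> z" by (intro tendsto_intros x)
    have "(\<lambda>n. w \<bullet> A (x n)) \<longlonglongrightarrow> w \<bullet> y" by (intro tendsto_intros x)
    then show "(\<lambda>n. A w \<bullet> x n) \<longlonglongrightarrow> w \<bullet> y" using self_adjoint_sym[OF sa w x(1)] by simp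
  qed
  then show "z \<in> D" "A z = y" using self_adjoint_domainI[OF sa] self_adjoint_valueI[OF sa] by blast+
qed

text \<open>Coercivity makes the operator injective with closed range, and a vector orthogonal to the
range lies in the kernel of the adjoint, which is the operator itself. The lemma is applied to
\<open>-A\<close>, to \<open>S S*\<close>, to the operators \<open>1 - \<epsilon> A\<close> and to a bounded perturbation of the identity.\<close>

lemma coercive_self_adjoint_inverse:
  fixes A :: "'z::{real_inner,banach} \<Rightarrow> 'z"
  assumes sa: "self_adjoint D A" and m: "m > 0" and co: "\<And>z. z \<in> D \<Longrightarrow> A z \<bullet> z \<ge> m * (norm z)\<^sup>2"
  shows "bij_betw A D UNIV"
    and "bounded_linear (inv_into D A)"
    and "inv_into D A x \<bullet> y = x \<bullet> inv_into D A y"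
    and "norm (inv_into D A x) \<le> norm x / m"
    and "inv_into D A x \<in> D"
    and "A (inv_into D A x) = x"
    and "z \<in> D \<Longrightarrow> inv_into D A (A z) = z"
proof -
  note subD = self_adjoint_linear(1)[OF sa]
  note add = self_adjoint_add[OF sa] and sc = self_adjoint_scaleR[OF sa]
  have diff: "A (x - y) = A x - A y" if "x \<in> D" "y \<in> D" for x y
    using add[of x "(-1) *\<^sub>R y"] sc[of y "-1"] that subspace_scale[OF subD that(2), of "-1"] by simp
  have below: "m * norm z \<le> norm (A z)" if "z \<in> D" for z
  proof (cases "z = 0")
    case False
    have "m * norm z * norm z \<le> norm (A z) * norm z"
      using co[OF that] norm_cauchy_schwarz[of "A z" z] by (simp add: power2_eq_square algebra_simps)
    then show ?thesis using False by simp
  qed simp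
  have inj: "inj_on A D"
  proof (rule inj_onI)
    fix x y assume xy: "x \<in> D" "y \<in> D" "A x = A y"
    have "m * norm (x - y) \<le> norm (A (x - y))" by (intro below subspace_diff subD xy)
    then show "x = y" using xy diff m by (simp add: mult_le_0_iff)
  qed
  have "subspace (A ` D)"
    unfolding subspace_def
  proof (intro conjI ballI allI)
    have "A 0 = 0" using sc[of 0 0] subspace_0[OF subD] by simp
    then show "0 \<in> A ` D" using subspace_0[OF subD] by (metis imageI)
    show "x + y \<in> A ` D" if xy: "x \<in> A ` D" "y \<in> A ` D" for x y
    proof -
      obtain a b where ab: "a \<in> D" "b \<in> D" "x = A a" "y = A b" using xy by blast
      then have "x + y = A (a + b)" by (simp add: add)
      then show ?thesis using subspace_add[OF subD ab(1,2)] by blast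
    qed
    show "c *\<^sub>R x \<in> A ` D" if x: "x \<in> A ` D" for c x
    proof -
      obtain a where a: "a \<in> D" "x = A a" using x by blast
      then have "c *\<^sub>R x = A (c *\<^sub>R a)" by (simp add: sc)
      then show ?thesis using subspace_scale[OF subD a(1)] by blast
    qed
  qed
  moreover have "closed (A ` D)"
    unfolding closed_sequential_limits
  proof (intro allI impI, elim conjE)
    fix y l assume "\<forall>n. y n \<in> A ` D" and l: "y \<longlonglongrightarrow> l"
    then obtain x where x: "\<And>n. x n \<in> D" "\<And>n. y n = A (x n)"
      unfolding image_iff Bex_def by (metis (no_types))
    have "Cauchy x"
    proof (rule metric_CauchyI)
      fix e :: real assume "e > 0"
      then obtain N where N: "\<And>i j. i \<ge> N \<Longrightarrow> j \<ge> N \<Longrightarrow> dist (y i) (y j) < m * e"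
        using metric_CauchyD[OF LIMSEQ_imp_Cauchy[OF l], of "m * e"] m by auto
      have "dist (x i) (x j) < e" if "i \<ge> N" "j \<ge> N" for i j
      proof -
        have "m * norm (x i - x j) \<le> norm (A (x i - x j))"
          using x subD by (intro below subspace_diff)
        also have "\<dots> < m * e" using N[OF that] x diff by (simp add: dist_norm)
        finally show ?thesis using m by (simp add: dist_norm)
      qed
      then show "\<exists>N. \<forall>i\<ge>N. \<forall>j\<ge>N. dist (x i) (x j) < e" by blast
    qed
    then obtain z where z: "x \<longlonglongrightarrow> z" using Cauchy_convergent_iff convergent_def by blast
    have "(\<lambda>n. A (x n)) \<longlonglongrightarrow> l" using l by (simp add: x(2)[symmetric])
    from self_adjoint_closed[OF sa x(1) z this] show "l \<in> A ` D" by blast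
  qed
  moreover have "u = 0" if u: "\<And>y. y \<in> A ` D \<Longrightarrow> y \<bullet> u = 0" for u
  proof -
    have "A x \<bullet> u = x \<bullet> 0" if "x \<in> D" for x using u that by simp
    then have "u \<in> D" "A u = 0"
      using self_adjoint_domainI[OF sa] self_adjoint_valueI[OF sa] by blast+
    then show "u = 0" using below[of u] m by (simp add: mult_le_0_iff)
  qed
  ultimately have ran: "A ` D = UNIV" using orthogonal_to_closed_subspace_exists[of "A ` D"] by metis
  show bij: "bij_betw A D UNIV" using inj ran by (simp add: bij_betw_def)
  let ?B = "inv_into D A"
  have BD: "?B x \<in> D" for x by (rule inv_into_into) (simp add: ran)
  have AB: "A (?B x) = x" for x by (rule f_inv_into_f) (simp add: ran)
  have BA: "?B (A z) = z" if "z \<in> D" for z using inj that by (rule inv_into_f_f)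
  have nB: "norm (?B x) \<le> norm x / m" for x
    using below[OF BD, of x] m by (simp add: AB field_simps)
  show "bounded_linear ?B"
  proof (rule bounded_linear_intro)
    show "?B (x + y) = ?B x + ?B y" for x y
      using BA[of "?B x + ?B y"] BD subspace_add[OF subD] add AB by simp
    show "?B (r *\<^sub>R x) = r *\<^sub>R ?B x" for r x
      using BA[of "r *\<^sub>R ?B x"] BD subspace_scale[OF subD] sc AB by simp
    show "norm (?B x) \<le> norm x * (1 / m)" for x using nB[of x] by simp
  qed
  show "?B x \<bullet> y = x \<bullet> ?B y" using self_adjoint_sym[OF sa BD BD, of x y] AB by simp
  show "norm (?B x) \<le> norm x / m" "?B x \<in> D" "A (?B x) = x" by (rule nB BD AB)+
  show "inv_into D A (A z) = z" if "z \<in> D" using that by (rule BA)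
qed

lemma self_adjoint_bounded:
  assumes "bounded_linear B" "\<And>x y. B x \<bullet> y = x \<bullet> B y"
  shows "self_adjoint UNIV B"
  unfolding self_adjoint_def by (simp add: assms(2) vector_eq_ldot) (auto simp: eq_commute)

section \<open>Strongly continuous semigroups\<close>

text \<open>The principle of uniform boundedness, for sequences of operators.\<close>

lemma uniform_boundedness:
  fixes f :: "nat \<Rightarrow> 'a::banach \<Rightarrow> 'b::real_normed_vector"
  assumes lin: "\<And>n. bounded_linear (f n)" and bd: "\<And>x. bounded (range (\<lambda>n. f n x))"
  obtains M where "\<And>n x. norm (f n x) \<le> M * norm x"
proof -
  \<comment> \<open>the sets \<open>F k\<close> are closed and cover the space, so one of them contains a ball\<close>
  define F where "F k = {x. \<forall>n. norm (f n x) \<le> real k}" for k :: nat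
  have clF: "closed (F k)" for k
  proof -
    have "F k = (\<Inter>n. {x. norm (f n x) \<le> real k})" unfolding F_def by auto
    moreover have "closed {x. norm (f n x) \<le> real k}" for n
      by (intro closed_Collect_le continuous_on_norm continuous_on_const linear_continuous_on lin)
    ultimately show ?thesis by (simp add: closed_INT)
  qed
  have "(\<Union>k. F k) = UNIV"
  proof -
    have "\<exists>k. x \<in> F k" for x
    proof -
      obtain b where "\<And>n. norm (f n x) \<le> b" using bd[of x] unfolding bounded_iff by auto
      moreover obtain k :: nat where "b \<le> real k" using real_arch_simple by blast
      ultimately have "\<forall>n. norm (f n x) \<le> real k" by (meson order_trans)
      then show ?thesis unfolding F_def by blast
    qed
    then show ?thesis by blast
  qed
  have "\<exists>k. interior (F k) \<noteq> {}"
  proof (rule ccontr)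
    assume "\<not> ?thesis"
    then have nowhere: "closedin euclidean T \<and> euclidean interior_of T = {}" if "T \<in> range F" for T
      using that clF by auto
    have "euclidean interior_of (\<Union>(range F)) = {}"
      by (rule Baire_category_alt[OF _ _ nowhere])
         (simp_all add: completely_metrizable_space_euclidean)
    then show False using \<open>(\<Union>k. F k) = UNIV\<close> by simp
  qed
  then obtain k a where "a \<in> interior (F k)" by blast
  then obtain r where r: "r > 0" "cball a r \<subseteq> F k" unfolding mem_interior_cball by blast
  have "norm (f n x) \<le> (2 * real k / r) * norm x" for n x
  proof (cases "x = 0")
    case True then show ?thesis using linear_0[OF bounded_linear.linear[OF lin]] by simp
  next
    case False
    interpret bounded_linear "f n" by (rule lin)
    define c where "c = r / norm x"
    have "a + c *\<^sub>R x \<in> cball a r" "a \<in> cball a r"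
      using False r(1) unfolding c_def by (auto simp: dist_norm)
    then have "norm (f n (a + c *\<^sub>R x)) \<le> k" "norm (f n a) \<le> k" using subsetD[OF r(2)] unfolding F_def by blast+
    moreover have "c *\<^sub>R f n x = f n (a + c *\<^sub>R x) - f n a" by (simp add: add scale)
    ultimately have "norm (c *\<^sub>R f n x) \<le> 2 * k"
      using norm_triangle_ineq4[of "f n (a + c *\<^sub>R x)" "f n a"] by simp
    then show ?thesis using r(1) False unfolding c_def by (simp add: field_simps)
  qed
  then show thesis by (rule that)
qed

lemma semigroup_linear:
  assumes "c0_semigroup sc T" "t \<ge> 0"
  shows "bounded_linear (T t)"
  using assms unfolding c0_semigroup_def bounded_ops_def by blast

lemma semigroup_add:
  assumes "c0_semigroup sc T" "s \<ge> 0" "t \<ge> 0"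
  shows "T (s + t) z = T s (T t z)"
  using assms unfolding c0_semigroup_def by simp

lemma semigroup_zero: "c0_semigroup sc T \<Longrightarrow> T 0 z = z"
  unfolding c0_semigroup_def by simp

lemma semigroup_scalar:
  assumes "c0_semigroup sc T" "t \<ge> 0"
  shows "T t (sc a z) = sc a (T t z)"
  using assms unfolding c0_semigroup_def bounded_ops_def by blast

lemma semigroup_tendsto:
  assumes "c0_semigroup sc T"
  shows "((\<lambda>t. T t z) \<longlongrightarrow> z) (at 0 within {0..})"
proof -
  have "{0..} - {0} = {0::real<..} - {0}" by auto
  then have "at 0 within {0..} = at_right (0::real)" by (simp only: at_within_def)
  then show ?thesis using assms unfolding c0_semigroup_def by simp
qed

text \<open>If the operators were unbounded near \<open>0\<close>, then some sequence \<open>T (\<tau> n)\<close> with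
\<open>\<tau> n \<longlonglongrightarrow> 0\<close> would be pointwise convergent without being uniformly bounded. The
bound is carried from a neighbourhood of \<open>0\<close> to \<open>[0, a]\<close> by the semigroup law.\<close>

lemma semigroup_locally_bounded:
  assumes sg: "c0_semigroup sc T"
  obtains M where "M \<ge> 0" "\<And>t z. 0 \<le> t \<Longrightarrow> t \<le> a \<Longrightarrow> norm (T t z) \<le> M * norm z"
proof -
  have near: "\<exists>\<delta>>0. \<forall>h. 0 \<le> h \<and> h < \<delta> \<longrightarrow> norm (T h z - z) < e" if "e > 0" for z e
  proof -
    obtain d where "d > 0" and d: "\<And>h. h \<in> {0..} \<Longrightarrow> h \<noteq> 0 \<Longrightarrow> dist h 0 < d \<Longrightarrow> dist (T h z) z < e"
      using semigroup_tendsto[OF sg, of z, unfolded tendsto_iff eventually_at] \<open>e > 0\<close> by blast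
    have "norm (T h z - z) < e" if "0 \<le> h \<and> h < d" for h
      using d[of h] that \<open>e > 0\<close> semigroup_zero[OF sg, of z] by (cases "h = 0") (auto simp: dist_norm)
    then show ?thesis using \<open>d > 0\<close> by blast
  qed
  have "\<exists>n::nat. \<forall>t z. 0 \<le> t \<and> t \<le> 1 / Suc n \<longrightarrow> norm (T t z) \<le> real n * norm z"
  proof (rule ccontr)
    assume "\<not> ?thesis"
    then have "\<forall>n::nat. \<exists>t z. 0 \<le> t \<and> t \<le> 1 / Suc n \<and> norm (T t z) > real n * norm z"
      by (simp add: not_le)
    then obtain \<tau> z where \<tau>: "\<And>n. 0 \<le> \<tau> n" "\<And>n. \<tau> n \<le> 1 / Suc n"
      and z: "\<And>n::nat. norm (T (\<tau> n) (z n)) > real n * norm (z n)" by metis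
    have "bounded (range (\<lambda>n. T (\<tau> n) x))" for x
    proof -
      have "(\<lambda>n. T (\<tau> n) x) \<longlonglongrightarrow> x"
      proof (rule LIMSEQ_I)
        fix r :: real assume "r > 0"
        then obtain d where "d > 0" and d: "\<And>h. 0 \<le> h \<Longrightarrow> h < d \<Longrightarrow> norm (T h x - x) < r"
          using near by blast
        obtain N where N: "1 / real (Suc N) < d"
          using reals_Archimedean[OF \<open>d > 0\<close>] by (auto simp: inverse_eq_divide)
        have "norm (T (\<tau> n) x - x) < r" if "n \<ge> N" for n
        proof -
          have "1 / real (Suc n) \<le> 1 / real (Suc N)" using that by (simp add: frac_le)
          then show ?thesis using d \<tau>[of n] N by (meson order_le_less_trans)
        qed
        then show "\<exists>N. \<forall>n\<ge>N. norm (T (\<tau> n) x - x) < r" by blast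
      qed
      then show ?thesis using convergent_imp_bounded by blast
    qed
    then obtain M where M: "\<And>n x. norm (T (\<tau> n) x) \<le> M * norm x"
      using uniform_boundedness[of "\<lambda>n. T (\<tau> n)"] semigroup_linear[OF sg \<tau>(1)] by metis
    obtain n :: nat where "M \<le> n" using real_arch_simple by blast
    then have "M * norm (z n) \<le> real n * norm (z n)" by (intro mult_right_mono) auto
    then show False using M[of n "z n"] z[of n] by simp
  qed
  then obtain n :: nat where n: "\<And>t z. 0 \<le> t \<Longrightarrow> t \<le> 1 / Suc n \<Longrightarrow> norm (T t z) \<le> real n * norm z"
    by blast
  let ?\<delta> = "1 / real (Suc n)"
  have "\<exists>M\<ge>0. \<forall>t z. 0 \<le> t \<and> t \<le> real k * ?\<delta> \<longrightarrow> norm (T t z) \<le> M * norm z" for k :: nat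
  proof (induction k)
    case 0
    then show ?case by (intro exI[of _ 1]) (auto simp: semigroup_zero[OF sg])
  next
    case (Suc k)
    then obtain M where M0: "M \<ge> 0"
      and M: "\<And>t z. 0 \<le> t \<Longrightarrow> t \<le> real k * ?\<delta> \<Longrightarrow> norm (T t z) \<le> M * norm z" by blast
    have "norm (T t z) \<le> (n + n * M) * norm z" if t: "0 \<le> t" "t \<le> real (Suc k) * ?\<delta>" for t z
    proof (cases "t \<le> ?\<delta>")
      case True
      then have "norm (T t z) \<le> n * norm z" using n t(1) by blast
      also have "\<dots> \<le> (n + n * M) * norm z" using M0 by (intro mult_right_mono) auto
      finally show ?thesis .
    next
      case False
      then have nn: "t - ?\<delta> \<ge> 0" by simp
      have le: "t - ?\<delta> \<le> real k * ?\<delta>" using t(2) by (simp add: algebra_simps add_divide_distrib)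
      have "T t z = T ?\<delta> (T (t - ?\<delta>) z)" using semigroup_add[OF sg _ nn, of ?\<delta> z] by simp
      then have "norm (T t z) \<le> n * norm (T (t - ?\<delta>) z)" using n[of ?\<delta>] by simp
      also have "\<dots> \<le> n * (M * norm z)" using M[OF nn le] by (intro mult_left_mono) auto
      also have "\<dots> \<le> (n + n * M) * norm z" by (simp add: algebra_simps)
      finally show ?thesis .
    qed
    moreover have "0 \<le> n + n * M" using M0 by simp
    ultimately show ?case by blast
  qed
  moreover obtain k :: nat where "a / ?\<delta> \<le> k" using real_arch_simple by blast
  then have "a \<le> real k * ?\<delta>" by (simp add: field_simps)
  ultimately obtain M where "M \<ge> 0" "\<And>t z. 0 \<le> t \<Longrightarrow> t \<le> a \<Longrightarrow> norm (T t z) \<le> M * norm z"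
    by (meson order_trans)
  then show thesis by (rule that)
qed

lemma semigroup_orbit_continuous:
  assumes sg: "c0_semigroup sc T"
  shows "continuous_on {0..} (\<lambda>t. T t z)"
  unfolding continuous_on_iff
proof (intro ballI allI impI)
  fix t e :: real assume t: "t \<in> {0..}" and e: "e > 0"
  obtain M where M0: "M \<ge> 0" and M: "\<And>s z. 0 \<le> s \<Longrightarrow> s \<le> t + 1 \<Longrightarrow> norm (T s z) \<le> M * norm z"
    using semigroup_locally_bounded[OF sg] by blast
  have "e / (M + 1) > 0" using e M0 by simp
  then obtain d where d0: "d > 0" and
    d: "\<And>h. h \<in> {0..} \<Longrightarrow> h \<noteq> 0 \<Longrightarrow> dist h 0 < d \<Longrightarrow> dist (T h z) z < e / (M + 1)"
    using semigroup_tendsto[OF sg, of z, unfolded tendsto_iff eventually_at] by blast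
  have key: "dist (T s z) (T r z) < e" if "0 \<le> s" "s \<le> r" "s \<le> t + 1" "r - s < d" for s r
  proof (cases "s = r")
    case False
    interpret bounded_linear "T s" by (rule semigroup_linear[OF sg that(1)])
    have "T r z - T s z = T s (T (r - s) z - z)"
      using semigroup_add[OF sg that(1), of "r - s" z] that by (simp add: diff)
    then have "norm (T r z - T s z) \<le> M * norm (T (r - s) z - z)"
      using M[OF that(1,3)] by simp
    also have "\<dots> \<le> (M + 1) * norm (T (r - s) z - z)" by (intro mult_right_mono) auto
    also have "\<dots> < (M + 1) * (e / (M + 1))"
      using d[of "r - s"] that False M0 by (intro mult_strict_left_mono) (auto simp: dist_norm)
    also have "\<dots> = e" using M0 by simp
    finally show ?thesis by (simp add: dist_norm norm_minus_commute)
  qed (use e in simp)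
  show "\<exists>d>0. \<forall>x'\<in>{0..}. dist x' t < d \<longrightarrow> dist (T x' z) (T t z) < e"
  proof (intro exI[of _ "min d 1"] conjI ballI impI)
    fix s assume s: "s \<in> {0..}" "dist s t < min d 1"
    show "dist (T s z) (T t z) < e"
    proof (cases "s \<le> t")
      case True then show ?thesis using key[of s t] s t by (auto simp: dist_real_def)
    next
      case False then show ?thesis using key[of t s] s t by (auto simp: dist_real_def dist_commute)
    qed
  qed (use d0 in simp)
qed

text \<open>Joint continuity yields the measurability of \<open>(\<tau>, s) \<mapsto> T (\<tau> - s) (F s)\<close>. Times are
truncated at \<open>0\<close>, because nothing is known about \<open>T t\<close> for negative \<open>t\<close>.\<close>

lemma semigroup_jointly_continuous:
  fixes T :: "real \<Rightarrow> 'z::{real_inner,banach} \<Rightarrow> 'z"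
  assumes sg: "c0_semigroup sc T"
  shows "continuous_on UNIV (\<lambda>x. T (max 0 (fst x)) (snd x))"
  unfolding continuous_on_def
proof
  fix x :: "real \<times> 'z"
  obtain M where M0: "M \<ge> 0"
    and M: "\<And>s z. 0 \<le> s \<Longrightarrow> s \<le> max 0 (fst x) + 1 \<Longrightarrow> norm (T s z) \<le> M * norm z"
    using semigroup_locally_bounded[OF sg] by blast
  have lim: "((\<lambda>y. M * norm (snd y - snd x) + norm (T (max 0 (fst y)) (snd x) - T (max 0 (fst x)) (snd x)))
      \<longlongrightarrow> M * norm (snd x - snd x) + norm (T (max 0 (fst x)) (snd x) - T (max 0 (fst x)) (snd x))) (at x)"
  proof (intro tendsto_intros)
    have "continuous_on UNIV (\<lambda>y::real \<times> 'z. T (max 0 (fst y)) (snd x))"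
      by (rule continuous_on_compose2[OF semigroup_orbit_continuous[OF sg]])
         (auto intro!: continuous_intros)
    then show "((\<lambda>y. T (max 0 (fst y)) (snd x)) \<longlongrightarrow> T (max 0 (fst x)) (snd x)) (at x)"
      unfolding continuous_on_def by blast
  qed
  show "((\<lambda>x. T (max 0 (fst x)) (snd x)) \<longlongrightarrow> T (max 0 (fst x)) (snd x)) (at x)"
  proof (rule LIM_zero_cancel)
    have "eventually (\<lambda>y. fst y < max 0 (fst x) + 1) (at x)"
      by (rule order_tendstoD(2)[of _ "fst x"]) (auto intro!: tendsto_intros)
    then have "eventually (\<lambda>y. norm (T (max 0 (fst y)) (snd y) - T (max 0 (fst x)) (snd x))
        \<le> M * norm (snd y - snd x) + norm (T (max 0 (fst y)) (snd x) - T (max 0 (fst x)) (snd x))) (at x)"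
    proof eventually_elim
      case (elim y)
      interpret bounded_linear "T (max 0 (fst y))" by (rule semigroup_linear[OF sg]) simp
      have "norm (T (max 0 (fst y)) (snd y - snd x)) \<le> M * norm (snd y - snd x)"
        by (rule M) (use elim in auto)
      then show ?case
        using norm_triangle_ineq[of "T (max 0 (fst y)) (snd y - snd x)"
            "T (max 0 (fst y)) (snd x) - T (max 0 (fst x)) (snd x)"] by (simp add: diff)
    qed
    then show "((\<lambda>y. T (max 0 (fst y)) (snd y) - T (max 0 (fst x)) (snd x)) \<longlongrightarrow> 0) (at x)"
      by (rule Lim_null_comparison) (use lim in simp)
  qed
qed

lemma generator_commutes:
  assumes sg: "c0_semigroup sc T" and gen: "infinitesimal_generator T D A" and t: "t \<ge> 0" and z: "z \<in> D"
  shows "T t z \<in> D" "A (T t z) = T t (A z)"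
proof -
  interpret bounded_linear "T t" by (rule semigroup_linear[OF sg t])
  have "((\<lambda>h. (T h z - z) /\<^sub>R h) \<longlongrightarrow> A z) (at_right 0)"
    using gen z unfolding infinitesimal_generator_def by blast
  then have "((\<lambda>h. T t ((T h z - z) /\<^sub>R h)) \<longlongrightarrow> T t (A z)) (at_right 0)" by (rule tendsto)
  moreover have "eventually (\<lambda>h. T t ((T h z - z) /\<^sub>R h) = (T h (T t z) - T t z) /\<^sub>R h) (at_right 0)"
  proof -
    have "T t (T h z) = T h (T t z)" if "h > 0" for h
      using semigroup_add[OF sg t, of h z] semigroup_add[OF sg _ t, of h z] that
      by (simp add: add.commute[of h t])
    then have "T t ((T h z - z) /\<^sub>R h) = (T h (T t z) - T t z) /\<^sub>R h" if "h > 0" for h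
      using that by (simp add: scale diff)
    then show ?thesis by (simp add: eventually_at_filter)
  qed
  ultimately have lim: "((\<lambda>h. (T h (T t z) - T t z) /\<^sub>R h) \<longlongrightarrow> T t (A z)) (at_right 0)"
    by (rule Lim_transform_eventually)
  then show TD: "T t z \<in> D" using gen unfolding infinitesimal_generator_def by blast
  then have "((\<lambda>h. (T h (T t z) - T t z) /\<^sub>R h) \<longlongrightarrow> A (T t z)) (at_right 0)"
    using gen unfolding infinitesimal_generator_def by blast
  then show "A (T t z) = T t (A z)" using lim tendsto_unique trivial_limit_at_right_real by blast
qed

text \<open>For \<open>z\<close> in the domain of the generator the orbit is differentiable from both sides. The
statement is weak, that is, tested against a fixed vector, so that the fundamental theorem of
calculus for real functions applies.\<close>

lemma semigroup_has_derivative: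
  assumes sg: "c0_semigroup sc T" and gen: "infinitesimal_generator T D A" and t: "t \<ge> 0" and z: "z \<in> D"
  shows "((\<lambda>s. T s z \<bullet> y) has_real_derivative T t (A z) \<bullet> y) (at t within {0..})"
  unfolding has_field_derivative_iff
proof -
  define q where "q h = (T h z - z) /\<^sub>R h" for h
  have q: "(q \<longlongrightarrow> A z) (at_right 0)"
    using gen z unfolding infinitesimal_generator_def q_def by blast
  have "filterlim (\<lambda>s. \<bar>s - t\<bar>) (at_right 0) (at t within {0..})"
    unfolding filterlim_at
  proof
    have "((\<lambda>s. \<bar>s - t\<bar>) \<longlongrightarrow> \<bar>t - t\<bar>) (at t within {0..})"
      by (intro tendsto_rabs tendsto_diff tendsto_ident_at tendsto_const)
    then show "((\<lambda>s. \<bar>s - t\<bar>) \<longlongrightarrow> 0) (at t within {0..})" by simp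
  qed (simp add: eventually_at_filter)
  then have "((\<lambda>s. q \<bar>s - t\<bar>) \<longlongrightarrow> A z) (at t within {0..})" by (rule filterlim_compose[OF q])
  moreover have "((\<lambda>s. min s t) \<longlongrightarrow> min t t) (at t within {0..})"
    by (intro tendsto_min tendsto_ident_at tendsto_const)
  ultimately have pair: "((\<lambda>s. (min s t, q \<bar>s - t\<bar>)) \<longlongrightarrow> (t, A z)) (at t within {0..})"
    using tendsto_Pair by fastforce
  have cont: "isCont (\<lambda>x. T (max 0 (fst x)) (snd x)) (t, A z)"
    using semigroup_jointly_continuous[OF sg] by (simp add: continuous_on_eq_continuous_at)
  from isCont_tendsto_compose[OF cont pair]
  have "((\<lambda>s. T (max 0 (min s t)) (q \<bar>s - t\<bar>)) \<longlongrightarrow> T (max 0 t) (A z)) (at t within {0..})"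
    by (simp only: fst_conv snd_conv)
  then have lim: "((\<lambda>s. T (max 0 (min s t)) (q \<bar>s - t\<bar>) \<bullet> y) \<longlongrightarrow> T t (A z) \<bullet> y) (at t within {0..})"
    using tendsto_inner[OF _ tendsto_const] t by fastforce
  \<comment> \<open>the difference quotient between \<open>s\<close> and \<open>t\<close> is \<open>T (min s t)\<close> applied to \<open>q \<bar>s - t\<bar>\<close>\<close>
  have eq: "T (max 0 (min s t)) (q \<bar>s - t\<bar>) \<bullet> y = (T s z \<bullet> y - T t z \<bullet> y) / (s - t)"
    if s: "s \<in> {0..}" "s \<noteq> t" for s
  proof (cases "s < t")
    case True
    interpret bounded_linear "T s" by (rule semigroup_linear[OF sg]) (use s in simp)
    have "T s (T (t - s) z) = T t z" using semigroup_add[OF sg, of s "t - s" z] s True by simp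
    then have "T s (q (t - s)) = (T t z - T s z) /\<^sub>R (t - s)" by (simp add: q_def scale diff)
    moreover have "max 0 (min s t) = s" using s True by auto
    ultimately show ?thesis using True
      by (simp add: inner_diff_left divide_simps) (simp add: algebra_simps)
  next
    case False
    interpret bounded_linear "T t" by (rule semigroup_linear[OF sg t])
    have "T t (T (s - t) z) = T s z" using semigroup_add[OF sg t, of "s - t" z] s False by simp
    then have "T t (q (s - t)) = (T s z - T t z) /\<^sub>R (s - t)" by (simp add: q_def scale diff)
    moreover have "max 0 (min s t) = t" using s t False by auto
    ultimately show ?thesis using False s
      by (simp add: inner_diff_left divide_simps)
  qed
  show "((\<lambda>s. (T s z \<bullet> y - T t z \<bullet> y) / (s - t)) \<longlongrightarrow> T t (A z) \<bullet> y) (at t within {0..})"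
    by (rule Lim_transform_eventually[OF lim]) (simp add: eventually_at_filter eq)
qed

section \<open>Mild solutions and indefinite integrals\<close>

text \<open>The fundamental theorem of calculus for the Bochner integral in a Hilbert space, with a
weak derivative.\<close>

lemma weak_FTC:
  fixes F f :: "real \<Rightarrow> 'z::{real_inner,banach,second_countable_topology}"
  assumes ab: "a \<le> b" and cont: "continuous_on {a..b} f"
    and deriv: "\<And>t y. t \<in> {a..b} \<Longrightarrow> ((\<lambda>s. F s \<bullet> y) has_real_derivative f t \<bullet> y) (at t within {a..b})"
  shows "(LINT s:{a..b}|lborel. f s) = F b - F a"
proof -
  have int: "integrable lborel (\<lambda>s. indicator {a..b} s *\<^sub>R f s)"
    using borel_integrable_atLeastAtMost'[OF cont] by (simp add: set_integrable_def)
  have "(LINT s:{a..b}|lborel. f s) \<bullet> y = (F b - F a) \<bullet> y" for y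
  proof -
    have "(LINT s:{a..b}|lborel. f s) \<bullet> y = (\<integral>s. (indicator {a..b} s *\<^sub>R f s) \<bullet> y \<partial>lborel)"
      unfolding set_lebesgue_integral_def by (rule integral_inner_left[symmetric]) (rule int)
    also have "\<dots> = (\<integral>s. indicator {a..b} s *\<^sub>R (f s \<bullet> y) \<partial>lborel)" by simp
    also have "\<dots> = F b \<bullet> y - F a \<bullet> y"
      using deriv unfolding has_real_derivative_iff_has_vector_derivative
      by (intro integral_FTC_atLeastAtMost ab continuous_intros cont) auto
    finally show ?thesis by (simp add: inner_diff_left)
  qed
  then show ?thesis using vector_eq_rdot by blast
qed

lemma semigroup_shifted_derivative:
  assumes sg: "c0_semigroup sc T" and gen: "infinitesimal_generator T D A" and z: "z \<in> D"
    and s: "s \<le> \<tau>" "S \<subseteq> {s..}"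
  shows "((\<lambda>\<tau>. T (\<tau> - s) z \<bullet> y) has_real_derivative T (\<tau> - s) (A z) \<bullet> y) (at \<tau> within S)"
proof -
  have "((\<lambda>r. T r z \<bullet> y) has_real_derivative T (\<tau> - s) (A z) \<bullet> y) (at (\<tau> - s) within {0..})"
    by (rule semigroup_has_derivative[OF sg gen _ z]) (use s in simp)
  then have d: "((\<lambda>r. T r z \<bullet> y) has_real_derivative T (\<tau> - s) (A z) \<bullet> y)
      (at (\<tau> - s) within (\<lambda>\<tau>. \<tau> - s) ` S)"
    by (rule DERIV_subset) (use s in auto)
  have "((\<lambda>\<tau>. \<tau> - s) has_real_derivative 1) (at \<tau> within S)" by (auto intro!: derivative_eq_intros)
  from DERIV_image_chain[OF d this] show ?thesis by (simp add: o_def)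
qed

lemma semigroup_orbit_continuous_compose:
  assumes sg: "c0_semigroup sc T" and h: "continuous_on S h" "\<And>x. x \<in> S \<Longrightarrow> h x \<ge> 0" and g: "continuous_on S g"
  shows "continuous_on S (\<lambda>x. T (h x) (g x))"
proof -
  have "continuous_on S (\<lambda>x. T (max 0 (fst (h x, g x))) (snd (h x, g x)))"
    by (rule continuous_on_compose2[OF semigroup_jointly_continuous[OF sg], where f = "\<lambda>x. (h x, g x)"])
       (auto intro!: continuous_intros h g)
  then show ?thesis using h(2) by (simp cong: continuous_on_cong)
qed

lemma semigroup_integral:
  fixes T :: "real \<Rightarrow> 'z::{real_inner,banach,second_countable_topology} \<Rightarrow> 'z"
  assumes sg: "c0_semigroup sc T" and gen: "infinitesimal_generator T D A" and z: "z \<in> D" and "s \<le> t"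
  shows "(LINT \<tau>:{s..t}|lborel. T (\<tau> - s) (A z)) = T (t - s) z - z"
proof -
  have "(LINT \<tau>:{s..t}|lborel. T (\<tau> - s) (A z)) = T (t - s) z - T (s - s) z"
  proof (rule weak_FTC[OF \<open>s \<le> t\<close>])
    show "continuous_on {s..t} (\<lambda>\<tau>. T (\<tau> - s) (A z))"
      by (rule semigroup_orbit_continuous_compose[OF sg]) (auto intro!: continuous_intros)
    show "((\<lambda>\<tau>. T (\<tau> - s) z \<bullet> y) has_real_derivative T (\<tau> - s) (A z) \<bullet> y) (at \<tau> within {s..t})"
      if "\<tau> \<in> {s..t}" for \<tau> y
      by (rule semigroup_shifted_derivative[OF sg gen z]) (use that in auto)
  qed
  then show ?thesis using semigroup_zero[OF sg] by simp
qed

lemma integrable_lborel_pair_mult: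
  fixes f g :: "real \<Rightarrow> real"
  assumes f: "integrable lborel f" and g: "integrable lborel g"
  shows "integrable (lborel \<Otimes>\<^sub>M lborel) (\<lambda>x. f (fst x) * g (snd x))"
proof (rule lborel_pair.Fubini_integrable)
  have [measurable]: "f \<in> borel_measurable borel" "g \<in> borel_measurable borel"
    using f g by (auto dest: borel_measurable_integrable)
  show "(\<lambda>x. f (fst x) * g (snd x)) \<in> borel_measurable (lborel \<Otimes>\<^sub>M lborel)" by measurable
  have "integrable lborel (\<lambda>x. \<bar>f x\<bar> * (\<integral>y. \<bar>g y\<bar> \<partial>lborel))" using f by simp
  then show "integrable lborel (\<lambda>x. \<integral>y. norm (f (fst (x, y)) * g (snd (x, y))) \<partial>lborel)"
    by (simp add: abs_mult)
  show "AE x in lborel. integrable lborel (\<lambda>y. f (fst (x, y)) * g (snd (x, y)))" using g by simp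
qed

text \<open>A mild solution of \<open>e' = A e + F\<close> solves the equation \<open>B e' = e + B F\<close> with \<open>B = A\<inverse>\<close>
in integrated form, without any regularity of \<open>e\<close> or \<open>F\<close>. This is Fubini's theorem for
\<open>T (\<tau> - s) (F s)\<close> on the triangle \<open>0 \<le> s \<le> \<tau> \<le> t\<close>: integration over \<open>s\<close> gives
\<open>e \<tau>\<close>, integration over \<open>\<tau>\<close> gives \<open>T (t - s) (B (F s)) - B (F s)\<close>.\<close>

lemma mild_solution_integrated:
  fixes T :: "real \<Rightarrow> 'z::{real_inner,banach,second_countable_topology} \<Rightarrow> 'z"
  assumes sg: "c0_semigroup sc T" and gen: "infinitesimal_generator T D A"
    and B: "bounded_linear B" "\<And>x. B x \<in> D" "\<And>x. A (B x) = x" "\<And>x. x \<in> D \<Longrightarrow> B (A x) = x"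
    and mild: "mild_solution T 0 F e" and t: "t \<ge> 0" and F: "set_integrable lborel {0..t} F"
  shows "set_integrable lborel {0..t} (\<lambda>s. e s + B (F s))"
    and "B (e t) = (LINT s:{0..t}|lborel. e s + B (F s))"
proof -
  have e_cont: "continuous_on {0..} e"
    and e: "\<And>s. s \<ge> 0 \<Longrightarrow> e s = (LINT r:{0..s}|lborel. T (s - r) (F r))"
    and Tint: "\<And>s. s \<ge> 0 \<Longrightarrow> set_integrable lborel {0..s} (\<lambda>r. T (s - r) (F r))"
    using mild linear_0[OF bounded_linear.linear[OF semigroup_linear[OF sg]]]
    unfolding mild_solution_def by auto
  have BT: "B (T r x) = T r (B x)" if "r \<ge> 0" for r x
    using generator_commutes[OF sg gen that B(2)[of x]] B(4)[of "T r (B x)"] by (simp add: B(3))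
  obtain M where M0: "M \<ge> 0" and M: "\<And>s z. 0 \<le> s \<Longrightarrow> s \<le> t \<Longrightarrow> norm (T s z) \<le> M * norm z"
    using semigroup_locally_bounded[OF sg] by blast
  define F0 where "F0 s = indicator {0..t} s *\<^sub>R F s" for s
  have F0: "integrable lborel F0" using F unfolding F0_def set_integrable_def .
  then have [measurable]: "F0 \<in> borel_measurable borel" by (auto dest: borel_measurable_integrable)
  define k where "k \<tau> s = (if 0 \<le> s \<and> s \<le> \<tau> \<and> \<tau> \<le> t then T (max 0 (\<tau> - s)) (F0 s) else 0)" for \<tau> s
  have k_int: "integrable (lborel \<Otimes>\<^sub>M lborel) (case_prod k)"
  proof (rule Bochner_Integration.integrable_bound)
    show "integrable (lborel \<Otimes>\<^sub>M lborel) (\<lambda>x. indicator {0..t} (fst x) * (M * norm (F0 (snd x))))"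
      by (rule integrable_lborel_pair_mult) (use F0 in \<open>auto intro!: integrable_real_indicator simp: emeasure_lborel_Icc_eq\<close>)
    have [measurable]: "(\<lambda>x. T (max 0 (fst x - snd x)) (F0 (snd x))) \<in> borel_measurable (borel \<Otimes>\<^sub>M borel)"
      by (rule borel_measurable_continuous_Pair[OF _ _ semigroup_jointly_continuous[OF sg]]) measurable
    show "case_prod k \<in> borel_measurable (lborel \<Otimes>\<^sub>M lborel)"
      unfolding k_def by (simp add: case_prod_beta)
    show "AE x in lborel \<Otimes>\<^sub>M lborel. norm (case_prod k x)
        \<le> norm (indicator {0..t} (fst x) * (M * norm (F0 (snd x))))"
      using M M0 by (intro always_eventually) (auto simp: k_def indicator_def)
  qed
  have inner_s: "(\<integral>s. k \<tau> s \<partial>lborel) = indicator {0..t} \<tau> *\<^sub>R e \<tau>" for \<tau>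
  proof (cases "\<tau> \<in> {0..t}")
    case True
    then have "k \<tau> = (\<lambda>s. indicator {0..\<tau>} s *\<^sub>R T (\<tau> - s) (F s))"
      by (auto simp: k_def F0_def indicator_def fun_eq_iff)
    then show ?thesis using True e[of \<tau>] by (simp add: set_lebesgue_integral_def)
  next
    case False
    then have "k \<tau> = (\<lambda>s. 0)" by (auto simp: k_def fun_eq_iff)
    then show ?thesis using False by simp
  qed
  have inner_\<tau>: "(\<integral>\<tau>. k \<tau> s \<partial>lborel) = indicator {0..t} s *\<^sub>R (T (t - s) (B (F s)) - B (F s))" for s
  proof (cases "s \<in> {0..t}")
    case True
    then have "(\<lambda>\<tau>. k \<tau> s) = (\<lambda>\<tau>. indicator {s..t} \<tau> *\<^sub>R T (\<tau> - s) (A (B (F s))))"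
      by (auto simp: k_def F0_def indicator_def fun_eq_iff B(3))
    then show ?thesis using True semigroup_integral[OF sg gen B(2), of s t "F s"]
      by (simp add: set_lebesgue_integral_def)
  next
    case False
    then have "(\<lambda>\<tau>. k \<tau> s) = (\<lambda>\<tau>. 0)" by (auto simp: k_def fun_eq_iff)
    then show ?thesis using False by simp
  qed
  have e_int: "set_integrable lborel {0..t} e"
    by (rule borel_integrable_atLeastAtMost', rule continuous_on_subset[OF e_cont]) auto
  have BF_int: "set_integrable lborel {0..t} (\<lambda>s. B (F s))"
    using integrable_bounded_linear[OF B(1) F0] linear_scale[OF bounded_linear.linear[OF B(1)]]
    unfolding F0_def set_integrable_def by simp
  have eq: "indicator {0..t} s *\<^sub>R T (t - s) (B (F s)) = B (indicator {0..t} s *\<^sub>R T (t - s) (F s))" for s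
    using BT[of "t - s" "F s"] linear_0[OF bounded_linear.linear[OF B(1)]] by (auto simp: indicator_def)
  have TBF_int: "set_integrable lborel {0..t} (\<lambda>s. T (t - s) (B (F s)))"
    using integrable_bounded_linear[OF B(1) Tint[OF t, unfolded set_integrable_def]]
    unfolding set_integrable_def eq .
  have "(LINT s:{0..t}|lborel. e s) = (\<integral>\<tau>. (\<integral>s. k \<tau> s \<partial>lborel) \<partial>lborel)"
    unfolding inner_s set_lebesgue_integral_def ..
  also have "\<dots> = (\<integral>s. (\<integral>\<tau>. k \<tau> s \<partial>lborel) \<partial>lborel)" by (rule lborel_pair.Fubini_integral[OF k_int, symmetric])
  also have "\<dots> = (LINT s:{0..t}|lborel. T (t - s) (B (F s)) - B (F s))"
    unfolding inner_\<tau> set_lebesgue_integral_def ..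
  also have "\<dots> = (LINT s:{0..t}|lborel. T (t - s) (B (F s))) - (LINT s:{0..t}|lborel. B (F s))"
    by (rule set_integral_diff[OF TBF_int BF_int])
  also have "(LINT s:{0..t}|lborel. T (t - s) (B (F s))) = B (e t)"
    unfolding e[OF t] set_lebesgue_integral_def eq
    by (rule integral_bounded_linear[OF B(1) Tint[OF t, unfolded set_integrable_def]])
  finally show "B (e t) = (LINT s:{0..t}|lborel. e s + B (F s))"
    using set_integral_add(2)[OF e_int BF_int] by simp
  show "set_integrable lborel {0..t} (\<lambda>s. e s + B (F s))" by (rule set_integral_add(1)[OF e_int BF_int])
qed

text \<open>The identity \<open>d/dt (M u \<bullet> u) = 2 (M u \<bullet> u')\<close> in integrated form, for an indefinite integral
\<open>u\<close> of an integrable function \<open>f\<close>. The double integral of \<open>M (f r) \<bullet> f s\<close> over the square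
splits into two triangles, and by the symmetry of \<open>M\<close> both contribute the same amount.\<close>

lemma quadratic_form_indefinite_integral:
  fixes f :: "real \<Rightarrow> 'z::{real_inner,banach,second_countable_topology}"
  assumes M: "bounded_linear M" "\<And>x y. M x \<bullet> y = x \<bullet> M y"
    and f: "set_integrable lborel {0..t} f" and t: "t \<ge> 0"
    and u: "\<And>s. s \<in> {0..t} \<Longrightarrow> u s = (LINT r:{0..s}|lborel. f r)"
  shows "set_integrable lborel {0..t} (\<lambda>s. M (u s) \<bullet> f s)"
    and "M (u t) \<bullet> u t = 2 * (LINT s:{0..t}|lborel. M (u s) \<bullet> f s)"
proof -
  define f0 where "f0 s = indicator {0..t} s *\<^sub>R f s" for s
  have f0: "integrable lborel f0" using f unfolding f0_def set_integrable_def .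
  then have [measurable]: "f0 \<in> borel_measurable borel" by (auto dest: borel_measurable_integrable)
  have [measurable]: "M \<in> borel_measurable borel"
    by (intro borel_measurable_continuous_onI linear_continuous_on M)
  obtain K where K0: "K \<ge> 0" and K: "\<And>x. norm (M x) \<le> norm x * K"
    using bounded_linear.nonneg_bounded[OF M(1)] by blast
  have dom: "integrable (lborel \<Otimes>\<^sub>M lborel) (\<lambda>x. norm (f0 (fst x)) * (norm (f0 (snd x)) * K))"
    by (rule integrable_lborel_pair_mult) (use f0 in auto)
  have bound: "norm (M (f0 r) \<bullet> f0 s) \<le> norm (norm (f0 s) * (norm (f0 r) * K))" for r s
  proof -
    have "\<bar>M (f0 r) \<bullet> f0 s\<bar> \<le> norm (M (f0 r)) * norm (f0 s)" by (rule Cauchy_Schwarz_ineq2)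
    also have "\<dots> \<le> (norm (f0 r) * K) * norm (f0 s)" by (intro mult_right_mono K) auto
    finally show ?thesis using K0 by (simp add: abs_mult mult_ac)
  qed
  define p where "p s r = (if r \<le> s then M (f0 r) \<bullet> f0 s else 0)" for s r
  define q where "q s r = (if s < r then M (f0 r) \<bullet> f0 s else 0)" for s r
  have p_int: "integrable (lborel \<Otimes>\<^sub>M lborel) (case_prod p)"
  proof (rule Bochner_Integration.integrable_bound[OF dom])
    show "case_prod p \<in> borel_measurable (lborel \<Otimes>\<^sub>M lborel)"
      unfolding p_def by (simp add: case_prod_beta)
    show "AE x in lborel \<Otimes>\<^sub>M lborel. norm (case_prod p x)
        \<le> norm (norm (f0 (fst x)) * (norm (f0 (snd x)) * K))"
      using bound by (intro always_eventually) (auto simp: p_def)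
  qed
  have q_int: "integrable (lborel \<Otimes>\<^sub>M lborel) (case_prod q)"
  proof (rule Bochner_Integration.integrable_bound[OF dom])
    show "case_prod q \<in> borel_measurable (lborel \<Otimes>\<^sub>M lborel)"
      unfolding q_def by (simp add: case_prod_beta)
    show "AE x in lborel \<Otimes>\<^sub>M lborel. norm (case_prod q x)
        \<le> norm (norm (f0 (fst x)) * (norm (f0 (snd x)) * K))"
      using bound by (intro always_eventually) (auto simp: q_def)
  qed
  have ind_int: "integrable lborel (\<lambda>r. indicator S r *\<^sub>R f0 r)" if "S \<in> sets lborel" for S
    by (rule integrable_mult_indicator[OF that f0])
  have u_eq: "u s = (\<integral>r. indicator {..s} r *\<^sub>R f0 r \<partial>lborel)" if "s \<in> {0..t}" for s
    unfolding u[OF that] set_lebesgue_integral_def f0_def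
    by (rule Bochner_Integration.integral_cong) (use that in \<open>auto simp: indicator_def\<close>)
  have u_eq': "u s = (\<integral>r. indicator {..<s} r *\<^sub>R f0 r \<partial>lborel)" if "s \<in> {0..t}" for s
    unfolding u_eq[OF that]
  proof (rule integral_cong_AE)
    show "AE r in lborel. indicator {..s} r *\<^sub>R f0 r = indicator {..<s} r *\<^sub>R f0 r"
      using AE_lborel_singleton[of s] by eventually_elim (auto simp: indicator_def)
  qed (measurable)
  have Mlin: "bounded_linear (\<lambda>x. M x \<bullet> c)" for c
    by (rule bounded_linear_compose[OF bounded_linear_inner_left M(1)])
  have Mlin': "bounded_linear (\<lambda>x. M c \<bullet> x)" for c
    by (rule bounded_linear_inner_right)
  have inner_p: "(\<integral>r. p s r \<partial>lborel) = indicator {0..t} s *\<^sub>R (M (u s) \<bullet> f s)" for s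
  proof (cases "s \<in> {0..t}")
    case True
    have "p s = (\<lambda>r. M (indicator {..s} r *\<^sub>R f0 r) \<bullet> f0 s)"
      using linear_0[OF bounded_linear.linear[OF M(1)]] by (auto simp: p_def indicator_def)
    moreover have "(\<integral>r. M (indicator {..s} r *\<^sub>R f0 r) \<bullet> f0 s \<partial>lborel) = M (u s) \<bullet> f0 s"
      unfolding u_eq[OF True] by (rule integral_bounded_linear[OF Mlin ind_int]) simp
    ultimately show ?thesis using True by (simp add: f0_def)
  next
    case False
    then have "p s = (\<lambda>r. 0)" by (auto simp: p_def f0_def)
    then show ?thesis using False by simp
  qed
  have inner_q: "(\<integral>s. q s r \<partial>lborel) = indicator {0..t} r *\<^sub>R (M (u r) \<bullet> f r)" for r
  proof (cases "r \<in> {0..t}")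
    case True
    have "(\<lambda>s. q s r) = (\<lambda>s. M (f0 r) \<bullet> (indicator {..<r} s *\<^sub>R f0 s))"
      by (auto simp: q_def indicator_def)
    moreover have "(\<integral>s. M (f0 r) \<bullet> (indicator {..<r} s *\<^sub>R f0 s) \<partial>lborel) = M (f0 r) \<bullet> u r"
      unfolding u_eq'[OF True] by (rule integral_bounded_linear[OF Mlin' ind_int]) simp
    ultimately show ?thesis using True M(2) by (simp add: f0_def inner_commute)
  next
    case False
    then have "(\<lambda>s. q s r) = (\<lambda>s. 0)"
      using linear_0[OF bounded_linear.linear[OF M(1)]] by (auto simp: q_def f0_def)
    then show ?thesis using False by simp
  qed
  show "set_integrable lborel {0..t} (\<lambda>s. M (u s) \<bullet> f s)"
    using lborel_pair.integrable_fst[OF p_int] unfolding inner_p set_integrable_def .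
  have ut: "u t = (\<integral>r. f0 r \<partial>lborel)"
    using u[of t] t by (simp add: f0_def set_lebesgue_integral_def)
  have "M (u t) \<bullet> u t = (\<integral>s. M (u t) \<bullet> f0 s \<partial>lborel)"
    unfolding ut by (rule integral_bounded_linear[OF Mlin' f0, symmetric])
  also have "\<dots> = (\<integral>s. (\<integral>r. M (f0 r) \<bullet> f0 s \<partial>lborel) \<partial>lborel)"
    unfolding ut by (subst integral_bounded_linear[OF Mlin f0]) simp
  also have "\<dots> = (\<integral>s. (\<integral>r. p s r + q s r \<partial>lborel) \<partial>lborel)"
    by (intro Bochner_Integration.integral_cong refl) (auto simp: p_def q_def)
  also have "\<dots> = integral\<^sup>L (lborel \<Otimes>\<^sub>M lborel) (\<lambda>(s, r). p s r + q s r)"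
    by (rule lborel_pair.integral_fst) (use Bochner_Integration.integrable_add[OF p_int q_int] in \<open>simp add: case_prod_unfold\<close>)
  also have "\<dots> = integral\<^sup>L (lborel \<Otimes>\<^sub>M lborel) (case_prod p) + integral\<^sup>L (lborel \<Otimes>\<^sub>M lborel) (case_prod q)"
    using Bochner_Integration.integral_add[OF p_int q_int] by (simp add: case_prod_unfold)
  also have "integral\<^sup>L (lborel \<Otimes>\<^sub>M lborel) (case_prod p) = (LINT s:{0..t}|lborel. M (u s) \<bullet> f s)"
    using lborel_pair.integral_fst[OF p_int] unfolding inner_p set_lebesgue_integral_def by simp
  also have "integral\<^sup>L (lborel \<Otimes>\<^sub>M lborel) (case_prod q) = (LINT s:{0..t}|lborel. M (u s) \<bullet> f s)"
    using lborel_pair.integral_snd[OF q_int] unfolding inner_q set_lebesgue_integral_def by simp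
  finally show "M (u t) \<bullet> u t = 2 * (LINT s:{0..t}|lborel. M (u s) \<bullet> f s)" by simp
qed

section \<open>Resolvents and the energy inequality\<close>

lemma strictly_negative_inverse:
  fixes A :: "'z::{real_inner,banach} \<Rightarrow> 'z"
  assumes sa: "self_adjoint D A" and neg: "strictly_negative D A"
  shows "bij_betw A D UNIV"
    and "bounded_linear (inv_into D A)"
    and "inv_into D A x \<bullet> y = x \<bullet> inv_into D A y"
    and "inv_into D A x \<in> D"
    and "A (inv_into D A x) = x"
    and "z \<in> D \<Longrightarrow> inv_into D A (A z) = z"
proof -
  let ?N = "\<lambda>z. - A z" and ?B = "inv_into D A"
  obtain m where saN: "self_adjoint D ?N" and m: "m > 0" "\<And>z. z \<in> D \<Longrightarrow> ?N z \<bullet> z \<ge> m * (norm z)\<^sup>2"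
    using neg unfolding strictly_negative_def strictly_positive_def by blast
  note N = coercive_self_adjoint_inverse[OF saN m]
  let ?B' = "inv_into D ?N"
  have inj: "inj_on A D" using N(1) unfolding bij_betw_def inj_on_def by auto
  have AB': "A (?B' (- x)) = x" for x using N(6)[of "- x"] by simp
  have eq: "?B x = ?B' (- x)" for x
    by (rule inv_into_f_eq[OF inj N(5) AB'])
  show BD: "?B x \<in> D" for x unfolding eq by (rule N(5))
  show AB: "A (?B x) = x" for x unfolding eq by (rule AB')
  show "?B (A z) = z" if "z \<in> D" for z using inj that by (rule inv_into_f_f)
  show "bij_betw A D UNIV" unfolding bij_betw_def
    using inj AB BD by (metis UNIV_eq_I imageI)
  show "?B x \<bullet> y = x \<bullet> ?B y" unfolding eq using N(3)[of "- x" y] N(3)[of x "- y"]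
    linear_neg[OF bounded_linear.linear[OF N(2)]] by simp
  have "bounded_linear (\<lambda>x. ?B' (- x))"
    by (rule bounded_linear_compose[OF N(2)]) (auto intro: bounded_linear_minus[OF bounded_linear_ident])
  then show "bounded_linear ?B" using eq by presburger
qed

lemma resolvent_self_adjoint:
  assumes sa: "self_adjoint D A" and \<epsilon>: "\<epsilon> \<noteq> 0"
  shows "self_adjoint D (\<lambda>z. z - \<epsilon> *\<^sub>R A z)"
  unfolding self_adjoint_def
proof (intro conjI allI)
  show "closure D = UNIV" by (rule self_adjoint_dense[OF sa])
  fix y y'
  show "(\<forall>x\<in>D. (x - \<epsilon> *\<^sub>R A x) \<bullet> y = x \<bullet> y') \<longleftrightarrow> y \<in> D \<and> y' = y - \<epsilon> *\<^sub>R A y"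
  proof
    assume l: "\<forall>x\<in>D. (x - \<epsilon> *\<^sub>R A x) \<bullet> y = x \<bullet> y'"
    have "A x \<bullet> y = x \<bullet> ((1 / \<epsilon>) *\<^sub>R (y - y'))" if "x \<in> D" for x
      using bspec[OF l that] \<epsilon> by (simp add: inner_diff_left inner_diff_right field_simps)
    then have "y \<in> D" "A y = (1 / \<epsilon>) *\<^sub>R (y - y')"
      using self_adjoint_domainI[OF sa] self_adjoint_valueI[OF sa] by blast+
    then show "y \<in> D \<and> y' = y - \<epsilon> *\<^sub>R A y" using \<epsilon> by simp
  next
    assume "y \<in> D \<and> y' = y - \<epsilon> *\<^sub>R A y"
    then show "\<forall>x\<in>D. (x - \<epsilon> *\<^sub>R A x) \<bullet> y = x \<bullet> y'"
      using self_adjoint_sym[OF sa] by (simp add: inner_diff_left inner_diff_right)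
  qed
qed

text \<open>A self-adjoint operator with non-positive quadratic form, together with a regularization
parameter \<open>\<epsilon>\<close>.\<close>

locale dissipative_resolvent =
  fixes D :: "'z::{real_inner,banach} set" and A :: "'z \<Rightarrow> 'z" and \<epsilon> :: real
  assumes sa: "self_adjoint D A" and diss: "\<And>z. z \<in> D \<Longrightarrow> A z \<bullet> z \<le> 0" and \<epsilon>: "\<epsilon> > 0"
begin

text \<open>The resolvent \<open>J = (1 - \<epsilon> A)\<inverse>\<close>. It is a symmetric contraction that maps into the
domain, commutes with \<open>A\<close>, and tends strongly to the identity as \<open>\<epsilon>\<close> tends to \<open>0\<close>.\<close>

definition J :: "'z \<Rightarrow> 'z" where "J = inv_into D (\<lambda>z. z - \<epsilon> *\<^sub>R A z)"

lemma resolvent: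
  shows linear_J: "bounded_linear J" and sym_J: "J x \<bullet> y = x \<bullet> J y" and contr_J: "norm (J x) \<le> norm x"
    and J_in: "J x \<in> D" and J_right: "J x - \<epsilon> *\<^sub>R A (J x) = x"
    and J_left: "z \<in> D \<Longrightarrow> J (z - \<epsilon> *\<^sub>R A z) = z"
proof -
  have co: "(z - \<epsilon> *\<^sub>R A z) \<bullet> z \<ge> 1 * (norm z)\<^sup>2" if "z \<in> D" for z
    using diss[OF that] \<epsilon> by (simp add: inner_diff_left power2_norm_eq_inner mult_nonneg_nonpos)
  have "self_adjoint D (\<lambda>z. z - \<epsilon> *\<^sub>R A z)" by (rule resolvent_self_adjoint[OF sa]) (use \<epsilon> in simp)
  note * = coercive_self_adjoint_inverse[OF this zero_less_one co, folded J_def]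
  show "bounded_linear J" "J x \<bullet> y = x \<bullet> J y" "norm (J x) \<le> norm x" "J x \<in> D"
    "J x - \<epsilon> *\<^sub>R A (J x) = x" using * by simp_all
  show "J (z - \<epsilon> *\<^sub>R A z) = z" if "z \<in> D" using *(7) that by simp
qed

sublocale J: bounded_linear J by (rule linear_J)

lemma AJ_eq: "A (J x) = (1 / \<epsilon>) *\<^sub>R (J x - x)"
proof -
  have "J x - x = \<epsilon> *\<^sub>R A (J x)" using J_right[of x] by (simp add: algebra_simps)
  then show ?thesis using \<epsilon> by simp
qed

lemma J_commutes: "z \<in> D \<Longrightarrow> A (J z) = J (A z)"
proof -
  assume z: "z \<in> D"
  have "J z - \<epsilon> *\<^sub>R J (A z) = z" using J_left[OF z] by (simp add: J.diff J.scale)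
  then have "J z - z = \<epsilon> *\<^sub>R J (A z)" by (simp add: algebra_simps)
  then show ?thesis unfolding AJ_eq using \<epsilon> by simp
qed

lemma J_close: "z \<in> D \<Longrightarrow> norm (J x - x) \<le> 2 * norm (x - z) + \<epsilon> * norm (A z)"
proof -
  assume z: "z \<in> D"
  have "J z - z = \<epsilon> *\<^sub>R J (A z)"
    using J_right[of z] J_commutes[OF z] by (simp add: algebra_simps)
  then have "norm (J z - z) \<le> \<epsilon> * norm (A z)" using \<epsilon> contr_J[of "A z"] by simp
  moreover have "norm (J (x - z)) \<le> norm (x - z)" by (rule contr_J)
  moreover have "J x - x = (J (x - z) - (x - z)) + (J z - z)" by (simp add: J.diff)
  then have "norm (J x - x) \<le> norm (J (x - z) - (x - z)) + norm (J z - z)"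
    by (simp only: norm_triangle_ineq)
  ultimately show ?thesis
    using norm_triangle_ineq4[of "J (x - z)" "x - z"] by linarith
qed

text \<open>The Yosida approximation \<open>K = A J\<close> of \<open>A\<close>, a bounded symmetric operator.\<close>

definition K :: "'z \<Rightarrow> 'z" where "K x = A (J x)"

lemma linear_K: "bounded_linear K"
  unfolding K_def AJ_eq
  by (rule bounded_linear_compose[OF bounded_linear_scaleR_right])
     (rule bounded_linear_sub[OF linear_J bounded_linear_ident])

lemma sym_K: "K x \<bullet> y = x \<bullet> K y"
  unfolding K_def AJ_eq by (simp add: inner_diff_left inner_diff_right sym_J)

lemma KJ: "K (J x) = J (K x)"
  unfolding K_def by (rule J_commutes[OF J_in])

text \<open>With \<open>g = J (J x)\<close>, the bounded operator \<open>M = K K K J\<close> is a regularization of \<open>A\<^sup>3\<close>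
for which \<open>M (B x) \<bullet> B x = A g \<bullet> g\<close>. For a solution of \<open>B x' = x + B y\<close> half of the
derivative of this quantity is the expression in the first statement. So the two statements
are the energy balance \<open>(A g \<bullet> g)' / 2 = \<parallel>A g\<parallel>\<^sup>2 + A g \<bullet> J (J y)\<close> and the sign of the energy.\<close>

lemma energy_inequality:
  assumes B: "bounded_linear B" "\<And>x. B x \<in> D" "\<And>x. A (B x) = x" "\<And>x. x \<in> D \<Longrightarrow> B (A x) = x"
    "\<And>x y. B x \<bullet> y = x \<bullet> B y"
  shows "K (K (K (J (B x)))) \<bullet> (x + B y) = (norm (A (J (J x))))\<^sup>2 + A (J (J x)) \<bullet> J (J y)"
    and "K (K (K (J (B x)))) \<bullet> B x \<le> 0"
proof -
  have KB: "K (B x) = J x" for x unfolding K_def using J_commutes[OF B(2)] by (simp add: B(3))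
  have M: "K (K (K (J (B x)))) = K (K (J (J x)))" by (simp add: KJ KB)
  have "K (K (J (J x))) \<bullet> x = K (J x) \<bullet> K (J x)" by (simp add: sym_K KJ sym_J)
  moreover have "K (K (J (J x))) \<bullet> B y = K (J x) \<bullet> J (J y)" by (simp add: sym_K KB KJ sym_J)
  ultimately show "K (K (K (J (B x)))) \<bullet> (x + B y) = (norm (A (J (J x))))\<^sup>2 + A (J (J x)) \<bullet> J (J y)"
    unfolding M by (simp add: inner_add_right K_def power2_norm_eq_inner)
  have "K (K (J (J x))) \<bullet> B x = K (J x) \<bullet> J (J x)" by (simp add: sym_K KB KJ sym_J)
  also have "\<dots> = A (J (J x)) \<bullet> J (J x)" by (simp add: K_def)
  also have "\<dots> \<le> 0" by (rule diss[OF J_in])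
  finally show "K (K (K (J (B x)))) \<bullet> B x \<le> 0" unfolding M .
qed

end

section \<open>The error of the optimal observer\<close>

text \<open>The pointwise estimate behind the upper bound. Here \<open>x\<close> is the value of the observer error,
\<open>w\<close> and \<open>v\<close> are the values of the disturbances, \<open>B = A\<inverse>\<close> and \<open>P = (S S*)\<inverse>\<close>. The
product with \<open>2\<close> on the right has non-positive time integral by the energy inequality. The
difference in brackets on the left tends to \<open>0\<close> with \<open>\<epsilon>\<close>, because all its terms tend to
\<open>C x \<bullet> P (C x)\<close>. The special form of the gain enters in the identity
\<open>A g \<bullet> J (J (B z)) = J (J g) \<bullet> z\<close>.\<close>

lemma (in dissipative_resolvent) dissipation_pointwise:
  fixes C :: "'z \<Rightarrow> 'y::{real_inner,banach}" and S :: "'v::{real_inner,banach} \<Rightarrow> 'y"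
  assumes B: "\<And>x. x \<in> D \<Longrightarrow> B (A x) = x" "\<And>x y. B x \<bullet> y = x \<bullet> B y"
    and C: "bounded_linear C" and S: "bounded_linear S"
    and P: "bounded_linear P" "\<And>x y. P x \<bullet> y = x \<bullet> P y" "\<And>y. S (adjoint S (P y)) = y"
    and \<gamma>: "\<gamma> \<ge> 0" "\<And>x. x \<in> D \<Longrightarrow> (norm (Q x))\<^sup>2 \<le> \<gamma> * ((norm (A x))\<^sup>2 + C x \<bullet> P (C x))"
  shows "(norm (Q (J (J x))))\<^sup>2 - \<gamma> * (C (J (J x)) \<bullet> P (C (J (J x)))
      + C (J (J (J (J x)))) \<bullet> P (C (J (J (J (J x))))) - 2 * (C (J (J (J (J x)))) \<bullet> P (C x)))
    \<le> \<gamma> * (2 * ((norm (A (J (J x))))\<^sup>2 + A (J (J x)) \<bullet> J (J (w + B (adjoint C (P (C x + S v))))))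
      + (norm w)\<^sup>2 + (norm v)\<^sup>2)"
proof -
  interpret P: bounded_linear P by (rule P)
  define g where "g = J (J x)"
  define p where "p = P (C (J (J g)))"
  have gD: "g \<in> D" unfolding g_def by (rule J_in)
  have contr: "norm (J (J w)) \<le> norm w" for w using contr_J order_trans by blast
  have inner_B: "A g \<bullet> J (J (B z)) = J (J g) \<bullet> z" for z
  proof -
    have "A g \<bullet> J (J (B z)) = J (J (A g)) \<bullet> B z" by (simp add: sym_J)
    also have "J (J (A g)) = A (J (J g))" by (simp add: J_commutes J_in gD)
    also have "A (J (J g)) \<bullet> B z = J (J g) \<bullet> z"
      using B(2)[of "A (J (J g))" z] B(1)[of "J (J g)"] J_in by simp
    finally show ?thesis .
  qed
  have "A g \<bullet> J (J (B (adjoint C (P (C x + S v))))) = C (J (J g)) \<bullet> P (C x) + C (J (J g)) \<bullet> P (S v)"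
    unfolding inner_B by (simp add: adjoint_inner[OF C, symmetric] P.add inner_add_right)
  also have "C (J (J g)) \<bullet> P (S v) = adjoint S p \<bullet> v"
    using adjoint_inner[OF S, of v p] P(2)[of "C (J (J g))" "S v"] by (simp add: p_def inner_commute)
  finally have 1: "A g \<bullet> J (J (w + B (adjoint C (P (C x + S v)))))
      = A g \<bullet> J (J w) + C (J (J g)) \<bullet> P (C x) + adjoint S p \<bullet> v"
    by (simp add: J.add inner_add_right)
  have young: "- (2 * (a \<bullet> b)) \<le> (norm a)\<^sup>2 + (norm b)\<^sup>2" for a b :: "'x::real_inner"
    using inner_ge_zero[of "a + b"] by (simp add: inner_add power2_norm_eq_inner inner_commute)
  have 2: "- (2 * (A g \<bullet> J (J w))) \<le> (norm (A g))\<^sup>2 + (norm w)\<^sup>2"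
    using young[of "A g" "J (J w)"] power_mono[OF contr norm_ge_zero, of w 2] by linarith
  have "(norm (adjoint S p))\<^sup>2 = C (J (J g)) \<bullet> P (C (J (J g)))"
    using adjoint_inner[OF S, of "adjoint S p" p] by (simp add: power2_norm_eq_inner p_def P(3))
  then have 3: "- (2 * (adjoint S p \<bullet> v)) \<le> C (J (J g)) \<bullet> P (C (J (J g))) + (norm v)\<^sup>2"
    using young[of "adjoint S p" v] by simp
  have arith: "a + d \<le> 2 * (a + (b + c + b')) + w' + v' + (d + d' - 2 * c)"
    if "- (2 * b) \<le> a + w'" "- (2 * b') \<le> d' + v'" for a b b' c d d' v' w' :: real
    using that by (simp add: algebra_simps)
  have "(norm (Q g))\<^sup>2 \<le> \<gamma> * ((norm (A g))\<^sup>2 + C g \<bullet> P (C g))" by (rule \<gamma>(2)[OF gD])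
  also have "\<dots> \<le> \<gamma> * ((2 * ((norm (A g))\<^sup>2 + A g \<bullet> J (J (w + B (adjoint C (P (C x + S v))))))
      + (norm w)\<^sup>2 + (norm v)\<^sup>2)
      + (C g \<bullet> P (C g) + C (J (J g)) \<bullet> P (C (J (J g))) - 2 * (C (J (J g)) \<bullet> P (C x))))"
    unfolding 1 by (rule mult_left_mono[OF arith[OF 2 3] \<gamma>(1)])
  finally show ?thesis unfolding g_def[symmetric] by (simp only: distrib_left)
qed

text \<open>The finite-horizon estimate for the error \<open>e\<close> of the observer with gain
\<open>A\<inverse> C* (S S*)\<inverse>\<close>. The pointwise estimate is integrated for \<open>\<epsilon> = 1 / (n + 1)\<close>, and
\<open>n\<close> is sent to infinity by dominated convergence.\<close>

lemma filter_bound: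
  fixes T :: "real \<Rightarrow> 'z::{real_inner,banach,second_countable_topology} \<Rightarrow> 'z"
    and C :: "'z \<Rightarrow> 'y::{real_inner,banach,second_countable_topology}"
    and S :: "'v::{real_inner,banach,second_countable_topology} \<Rightarrow> 'y"
    and Q :: "'z \<Rightarrow> 'q::{real_inner,banach,second_countable_topology}"
  assumes sg: "c0_semigroup sc T" and gen: "infinitesimal_generator T D A"
    and sa: "self_adjoint D A" and neg: "strictly_negative D A"
    and Q: "bounded_linear Q" and C: "bounded_linear C" and S: "bounded_linear S"
    and P: "bounded_linear P" "\<And>x y. P x \<bullet> y = x \<bullet> P y" "\<And>y. S (adjoint S (P y)) = y"
    and \<gamma>: "\<gamma> \<ge> 0" "\<And>x. x \<in> D \<Longrightarrow> (norm (Q x))\<^sup>2 \<le> \<gamma> * ((norm (A x))\<^sup>2 + C x \<bullet> P (C x))"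
    and mild: "mild_solution T 0 (\<lambda>s. w s + inv_into D A (adjoint C (P (C (e s) + S (v s))))) e"
    and t: "t \<ge> 0"
    and w: "set_borel_measurable lborel {0..t} w" "set_integrable lborel {0..t} (\<lambda>s. (norm (w s))\<^sup>2)"
    and v: "set_borel_measurable lborel {0..t} v" "set_integrable lborel {0..t} (\<lambda>s. (norm (v s))\<^sup>2)"
  shows "(LINT s:{0..t}|lborel. (norm (Q (e s)))\<^sup>2)
    \<le> \<gamma> * (LINT s:{0..t}|lborel. (norm (w s))\<^sup>2 + (norm (v s))\<^sup>2)"
proof -
  define B where "B = inv_into D A"
  note B = strictly_negative_inverse[OF sa neg, folded B_def]
  define F where "F s = w s + B (adjoint C (P (C (e s) + S (v s))))" for s
  have mild: "mild_solution T 0 F e" using mild unfolding F_def B_def .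
  have e_cont: "continuous_on {0..t} e"
    using mild unfolding mild_solution_def by (auto elim: continuous_on_subset)
  have diss: "A z \<bullet> z \<le> 0" if z: "z \<in> D" for z
  proof -
    obtain m where m: "m > 0" "- A z \<bullet> z \<ge> m * (norm z)\<^sup>2"
      using neg z unfolding strictly_negative_def strictly_positive_def by blast
    then have "0 \<le> m * (norm z)\<^sup>2" by simp
    then have "0 \<le> - A z \<bullet> z" using m(2) by (rule order_trans)
    then show ?thesis by simp
  qed
  have int_L1: "set_integrable lborel {0..t} f"
    if "set_borel_measurable lborel {0..t} f" "set_integrable lborel {0..t} (\<lambda>s. (norm (f s))\<^sup>2)"
    for f :: "real \<Rightarrow> 'x::{banach,second_countable_topology}"
    unfolding set_integrable_def
  proof (rule Bochner_Integration.integrable_bound)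
    have one: "set_integrable lborel {0..t} (\<lambda>s. 1::real)"
      by (rule borel_integrable_atLeastAtMost') (rule continuous_on_const)
    show "integrable lborel (\<lambda>s. indicator {0..t} s *\<^sub>R (1 + (norm (f s))\<^sup>2))"
      using set_integral_add(1)[OF one that(2)] unfolding set_integrable_def .
    show "(\<lambda>s. indicator {0..t} s *\<^sub>R f s) \<in> borel_measurable lborel"
      using that(1) unfolding set_borel_measurable_def .
    have "x \<le> 1 + x\<^sup>2" for x :: real using zero_le_power2[of "x - 1/2"] by (simp add: power2_eq_square algebra_simps)
    then show "AE s in lborel. norm (indicator {0..t} s *\<^sub>R f s) \<le> norm (indicator {0..t} s *\<^sub>R (1 + (norm (f s))\<^sup>2))"
      by (intro always_eventually) (auto simp: indicator_def)
  qed
  have cont_int: "set_integrable lborel {0..t} f" if "continuous_on {0..t} f"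
    for f :: "real \<Rightarrow> 'x::{banach,second_countable_topology}"
    by (rule borel_integrable_atLeastAtMost'[OF that])
  have blin_int: "set_integrable lborel {0..t} (\<lambda>s. X (f s))"
    if "bounded_linear X" "set_integrable lborel {0..t} f"
    for X :: "'c::{banach,second_countable_topology} \<Rightarrow> 'd::{banach,second_countable_topology}" and f
    using integrable_bounded_linear[OF that(1) that(2)[unfolded set_integrable_def]]
      linear_scale[OF bounded_linear.linear[OF that(1)]]
    unfolding set_integrable_def by simp
  have L: "bounded_linear (\<lambda>y. B (adjoint C (P y)))"
    by (intro bounded_linear_compose[OF B(2)] bounded_linear_compose[OF bounded_linear_adjoint[OF C]] P)
  have F_int: "set_integrable lborel {0..t} F"
    unfolding F_def
    by (intro set_integral_add(1) int_L1[OF w] blin_int[OF L] blin_int[OF C] blin_int[OF S]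
        int_L1[OF v] cont_int e_cont)
  define f where "f s = e s + B (F s)" for s
  note integ = mild_solution_integrated[OF sg gen B(2,4,5,6) mild, folded f_def]
  have f_int: "set_integrable lborel {0..t} f" unfolding f_def by (rule integ(1)[unfolded f_def]) (use t F_int in auto)
  have u: "B (e s) = (LINT r:{0..s}|lborel. f r)" if "s \<in> {0..t}" for s
  proof (rule integ(2))
    show "0 \<le> s" using that by simp
    show "set_integrable lborel {0..s} F" by (rule set_integrable_subset[OF F_int]) (use that in auto)
  qed
  interpret R: dissipative_resolvent D A "1 / real (Suc n)" for n
    by standard (use sa diss in auto)
  define J where "J n = dissipative_resolvent.J D A (1 / real (Suc n))" for n
  define K where "K n = dissipative_resolvent.K D A (1 / real (Suc n))" for n
  define M where "M n x = K n (K n (K n (J n x)))" for n x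
  define h where "h n s = (norm (A (J n (J n (e s)))))\<^sup>2 + A (J n (J n (e s))) \<bullet> J n (J n (F s))" for n s
  have KJ: "K n (J n x) = J n (K n x)" for n x unfolding K_def J_def by (rule R.KJ)
  have linM: "bounded_linear (M n)" for n
    unfolding M_def K_def J_def
    by (intro bounded_linear_compose[OF R.linear_K] R.linear_J)
  have symM: "M n x \<bullet> y = x \<bullet> M n y" for n x y
  proof -
    have "M n x \<bullet> y = x \<bullet> J n (K n (K n (K n y)))"
      unfolding M_def K_def J_def by (simp only: R.sym_K R.sym_J)
    then show ?thesis unfolding M_def by (simp add: KJ)
  qed
  have Mh: "M n (B (e s)) \<bullet> f s = h n s" for n s
    unfolding M_def f_def h_def K_def J_def by (rule R.energy_inequality(1)[OF B(2,4,5,6,3)])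
  have h_int: "set_integrable lborel {0..t} (h n)" for n
    using quadratic_form_indefinite_integral(1)[OF linM symM f_int t u] unfolding Mh .
  have h_le: "(LINT s:{0..t}|lborel. h n s) \<le> 0" for n
  proof -
    have "M n (B (e t)) \<bullet> B (e t) = 2 * (LINT s:{0..t}|lborel. h n s)"
      using quadratic_form_indefinite_integral(2)[OF linM symM f_int t u] unfolding Mh .
    moreover have "M n (B (e t)) \<bullet> B (e t) \<le> 0"
      unfolding M_def K_def J_def by (rule R.energy_inequality(2)[OF B(2,4,5,6,3)])
    ultimately show ?thesis by simp
  qed
  define H where "H x y = C x \<bullet> P (C y)" for x y
  \<comment> \<open>the left-hand side of the pointwise estimate\<close>
  define \<phi> where "\<phi> n x = (norm (Q (J n (J n x))))\<^sup>2 - \<gamma> * (H (J n (J n x)) (J n (J n x))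
      + H (J n (J n (J n (J n x)))) (J n (J n (J n (J n x)))) - 2 * H (J n (J n (J n (J n x)))) x)" for n x
  have \<phi>_le: "\<phi> n (e s) \<le> \<gamma> * (2 * h n s + ((norm (w s))\<^sup>2 + (norm (v s))\<^sup>2))" for n s
    using R.dissipation_pointwise[OF B(6,3) C S P \<gamma>, of n "e s" "w s" "v s"]
    unfolding \<phi>_def H_def h_def F_def J_def by (simp add: add.assoc)
  have contr: "norm (J n x) \<le> norm x" for n x unfolding J_def by (rule R.contr_J)
  have linJ: "bounded_linear (J n)" for n unfolding J_def by (rule R.linear_J)
  have \<phi>_cont: "continuous_on {0..t} (\<lambda>s. \<phi> n (e s))" for n
    unfolding \<phi>_def H_def
    by (intro continuous_intros bounded_linear.continuous_on[OF linJ] bounded_linear.continuous_on[OF Q]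
        bounded_linear.continuous_on[OF C] bounded_linear.continuous_on[OF P(1)] e_cont)
  have wv_int: "set_integrable lborel {0..t} (\<lambda>s. (norm (w s))\<^sup>2 + (norm (v s))\<^sup>2)"
    by (rule set_integral_add(1)[OF w(2) v(2)])
  have h2_int: "set_integrable lborel {0..t} (\<lambda>s. 2 * h n s)" for n using h_int by simp
  have bound_n: "(LINT s:{0..t}|lborel. \<phi> n (e s))
      \<le> \<gamma> * (LINT s:{0..t}|lborel. (norm (w s))\<^sup>2 + (norm (v s))\<^sup>2)" for n
  proof -
    have "(LINT s:{0..t}|lborel. \<phi> n (e s))
        \<le> (LINT s:{0..t}|lborel. \<gamma> * (2 * h n s + ((norm (w s))\<^sup>2 + (norm (v s))\<^sup>2)))"
      by (intro set_integral_mono cont_int \<phi>_cont \<phi>_le set_integrable_mult_right set_integral_add(1)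
          h2_int wv_int)
    also have "\<dots> = \<gamma> * (2 * (LINT s:{0..t}|lborel. h n s)
        + (LINT s:{0..t}|lborel. (norm (w s))\<^sup>2 + (norm (v s))\<^sup>2))"
      by (simp only: set_integral_mult_right set_integral_add(2)[OF h2_int wv_int])
    also have "\<dots> \<le> \<gamma> * (LINT s:{0..t}|lborel. (norm (w s))\<^sup>2 + (norm (v s))\<^sup>2)"
      using h_le by (intro mult_left_mono \<gamma>(1)) simp
    finally show ?thesis .
  qed
  \<comment> \<open>strong convergence to the identity, in a form that can be iterated\<close>
  have J_lim: "(\<lambda>n. J n (y n)) \<longlonglongrightarrow> x" if y: "y \<longlonglongrightarrow> x" for y x
  proof -
    have "(\<lambda>n. J n x) \<longlonglongrightarrow> x"
    proof (rule LIMSEQ_I)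
      fix r :: real assume r: "r > 0"
      have "x \<in> closure D" using self_adjoint_dense[OF sa] by simp
      then obtain z where z: "z \<in> D" "dist z x < r / 4"
        unfolding closure_approachable using r by (meson divide_pos_pos zero_less_numeral)
      obtain N where N: "norm (A z) / real (Suc N) < r / 2"
      proof -
        obtain N :: nat where "norm (A z) / (r / 2) < N" using reals_Archimedean2 by blast
        then have "norm (A z) < (r / 2) * real (Suc N)" using r by (simp add: field_simps)
        then have "norm (A z) / real (Suc N) < r / 2" by (simp add: pos_divide_less_eq)
        then show ?thesis by (rule that)
      qed
      have "norm (J n x - x) < r" if "n \<ge> N" for n
      proof -
        have "norm (A z) / real (Suc n) \<le> norm (A z) / real (Suc N)"
          using that by (intro divide_left_mono) auto
        moreover have "norm (J n x - x) \<le> 2 * norm (x - z) + norm (A z) / real (Suc n)"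
          using R.J_close[OF z(1), of n x] unfolding J_def by simp
        moreover have "norm (x - z) < r / 4" using z(2) by (simp add: dist_norm norm_minus_commute)
        ultimately show ?thesis using N by linarith
      qed
      then show "\<exists>N. \<forall>n\<ge>N. norm (J n x - x) < r" by blast
    qed
    moreover have "(\<lambda>n. J n (y n - x)) \<longlonglongrightarrow> 0"
    proof (rule Lim_null_comparison)
      show "\<forall>\<^sub>F n in sequentially. norm (J n (y n - x)) \<le> norm (y n - x)" by (simp add: contr)
      show "(\<lambda>n. norm (y n - x)) \<longlonglongrightarrow> 0" using y by (simp add: LIM_zero_iff tendsto_norm_zero_iff)
    qed
    ultimately have "(\<lambda>n. J n x + J n (y n - x)) \<longlonglongrightarrow> x + 0" by (rule tendsto_add)
    then show ?thesis by (simp add: linear_diff[OF bounded_linear.linear[OF linJ]])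
  qed
  have \<phi>_lim: "(\<lambda>n. \<phi> n x) \<longlonglongrightarrow> (norm (Q x))\<^sup>2" for x
  proof -
    have "(\<lambda>n. \<phi> n x) \<longlonglongrightarrow> (norm (Q x))\<^sup>2 - \<gamma> * (H x x + H x x - 2 * H x x)"
      unfolding \<phi>_def H_def
      by (intro tendsto_intros bounded_linear.tendsto[OF Q] bounded_linear.tendsto[OF C]
          bounded_linear.tendsto[OF P(1)] J_lim)
    then show ?thesis by simp
  qed
  obtain KQ where KQ: "KQ \<ge> 0" "\<And>x. norm (Q x) \<le> norm x * KQ"
    using bounded_linear.nonneg_bounded[OF Q] by blast
  obtain KC where KC: "KC \<ge> 0" "\<And>x. norm (C x) \<le> norm x * KC"
    using bounded_linear.nonneg_bounded[OF C] by blast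
  obtain KP where KP: "KP \<ge> 0" "\<And>x. norm (P (C x)) \<le> norm x * KP"
    using bounded_linear.nonneg_bounded[OF bounded_linear_compose[OF P(1) C]] by blast
  have "bounded (e ` {0..t})" by (intro compact_imp_bounded compact_continuous_image e_cont compact_Icc)
  then obtain E where E: "\<And>s. s \<in> {0..t} \<Longrightarrow> norm (e s) \<le> E"
    unfolding bounded_iff by (metis imageI)
  have E0: "E \<ge> 0" using E[of 0] t norm_ge_zero[of "e 0"] by (simp add: order_trans[OF norm_ge_zero])
  have H_bound: "\<bar>H x y\<bar> \<le> (E * KC) * (E * KP)" if "norm x \<le> E" "norm y \<le> E" for x y
  proof -
    have "\<bar>H x y\<bar> \<le> norm (C x) * norm (P (C y))" unfolding H_def by (rule Cauchy_Schwarz_ineq2)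
    also have "\<dots> \<le> (norm x * KC) * (norm y * KP)" by (intro mult_mono KC KP) (auto simp: KC)
    also have "\<dots> \<le> (E * KC) * (E * KP)" using that E0 KC KP by (intro mult_mono) auto
    finally show ?thesis .
  qed
  define W where "W = (E * KQ)\<^sup>2 + \<gamma> * (4 * ((E * KC) * (E * KP)))"
  have \<phi>_bound: "\<bar>\<phi> n (e s)\<bar> \<le> W" if s: "s \<in> {0..t}" for n s
  proof -
    let ?x = "e s" and ?c = "(E * KC) * (E * KP)"
    let ?X2 = "J n (J n ?x)"
    let ?X4 = "J n (J n (J n (J n ?x)))"
    have x: "norm ?x \<le> E" by (rule E[OF s])
    have x2: "norm ?X2 \<le> E" using contr x by (meson order_trans)
    have x4: "norm ?X4 \<le> E" using contr x2 by (meson order_trans)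
    have "norm (Q ?X2) \<le> E * KQ"
      using KQ(2)[of ?X2] x2 KQ(1) by (meson mult_right_mono order_trans)
    then have q: "(norm (Q ?X2))\<^sup>2 \<le> (E * KQ)\<^sup>2" by (intro power_mono) auto
    have "\<bar>H ?X2 ?X2 + H ?X4 ?X4 - 2 * H ?X4 ?x\<bar> \<le> 4 * ?c"
      using H_bound[OF x2 x2] H_bound[OF x4 x4] H_bound[OF x4 x] by linarith
    then have "\<bar>\<gamma> * (H ?X2 ?X2 + H ?X4 ?X4 - 2 * H ?X4 ?x)\<bar> \<le> \<gamma> * (4 * ?c)"
      using \<gamma>(1) by (simp add: abs_mult mult_left_mono)
    then show ?thesis using q unfolding \<phi>_def W_def by (smt (verit) zero_le_power2)
  qed
  have "(\<lambda>n. LINT s:{0..t}|lborel. \<phi> n (e s)) \<longlonglongrightarrow> (LINT s:{0..t}|lborel. (norm (Q (e s)))\<^sup>2)"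
    unfolding set_lebesgue_integral_def
  proof (rule integral_dominated_convergence)
    show "integrable lborel (\<lambda>s. indicator {0..t} s *\<^sub>R W)"
      using cont_int[OF continuous_on_const[of _ W]] unfolding set_integrable_def .
    show "(\<lambda>s. indicator {0..t} s *\<^sub>R \<phi> n (e s)) \<in> borel_measurable lborel" for n
      using cont_int[OF \<phi>_cont] unfolding set_integrable_def by (rule borel_measurable_integrable)
    have "continuous_on {0..t} (\<lambda>s. (norm (Q (e s)))\<^sup>2)"
      by (intro continuous_intros bounded_linear.continuous_on[OF Q] e_cont)
    then show "(\<lambda>s. indicator {0..t} s *\<^sub>R (norm (Q (e s)))\<^sup>2) \<in> borel_measurable lborel"
      using cont_int unfolding set_integrable_def by (blast intro: borel_measurable_integrable)
    show "AE s in lborel. (\<lambda>n. indicator {0..t} s *\<^sub>R \<phi> n (e s)) \<longlonglongrightarrow> indicator {0..t} s *\<^sub>R (norm (Q (e s)))\<^sup>2"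
      by (intro always_eventually allI tendsto_scaleR tendsto_const \<phi>_lim)
    show "AE s in lborel. norm (indicator {0..t} s *\<^sub>R \<phi> n (e s)) \<le> indicator {0..t} s *\<^sub>R W" for n
      using \<phi>_bound by (intro always_eventually) (auto simp: indicator_def)
  qed
  then show ?thesis by (rule LIMSEQ_le_const2) (use bound_n in blast)
qed

lemma L2_norm_power2: "(L2_norm f)\<^sup>2 = (\<integral>\<^sup>+ t\<in>{0..}. ennreal ((norm (f t))\<^sup>2) \<partial>lborel)"
  unfolding L2_norm_def Let_def
  by (auto simp: ennreal_power ennreal_top_eq_mult_iff power2_eq_square top.not_eq_extremum
      simp flip: ennreal_mult)

lemma power2_le_iff_ennreal: "(a::ennreal)\<^sup>2 \<le> b\<^sup>2 \<longleftrightarrow> a \<le> b"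
proof
  show "a \<le> b" if le: "a\<^sup>2 \<le> b\<^sup>2"
  proof (cases "b = top")
    case False
    then have "b\<^sup>2 < top" by (simp add: power2_eq_square ennreal_mult_less_top less_top)
    then have "a\<^sup>2 < top" using le by (rule le_less_trans[rotated])
    then have "a \<noteq> top" by (auto simp: power2_eq_square)
    then obtain r s where "a = ennreal r" "r \<ge> 0" "b = ennreal s" "s \<ge> 0"
      using False by (cases a; cases b) auto
    then show ?thesis using le by (simp add: ennreal_power ennreal_leI)
  qed simp
  show "a\<^sup>2 \<le> b\<^sup>2" if "a \<le> b" using that by (rule power_mono) simp
qed

text \<open>Bounds on all finite horizons pass to the half line by monotone convergence.\<close>

lemma nn_integral_Ici_le:
  fixes g :: "real \<Rightarrow> real"
  assumes cont: "continuous_on {0..} g" and nonneg: "\<And>t. g t \<ge> 0"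
    and le: "\<And>n::nat. (LINT s:{0..real n}|lborel. g s) \<le> c"
  shows "(\<integral>\<^sup>+ t\<in>{0..}. ennreal (g t) \<partial>lborel) \<le> ennreal c"
proof -
  define f where "f n t = ennreal (g t) * indicator {0..real n} t" for n t
  have int: "set_integrable lborel {0..real n} g" for n
    by (rule borel_integrable_atLeastAtMost', rule continuous_on_subset[OF cont]) auto
  have f_eq: "f n = (\<lambda>t. ennreal (indicator {0..real n} t *\<^sub>R g t))" for n
    by (auto simp: f_def indicator_def fun_eq_iff)
  have f_meas: "f n \<in> borel_measurable lborel" for n
    unfolding f_eq using int[of n] unfolding set_integrable_def
    by (intro measurable_compose[OF borel_measurable_integrable measurable_ennreal])
  have "incseq f"
    by (intro incseq_SucI le_funI) (auto simp: f_def indicator_def)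
  have "(\<integral>\<^sup>+ t\<in>{0..}. ennreal (g t) \<partial>lborel) = (\<integral>\<^sup>+ t. (SUP n. f n t) \<partial>lborel)"
  proof (rule nn_integral_cong)
    fix t
    show "ennreal (g t) * indicator {0..} t = (SUP n. f n t)"
    proof (rule antisym)
      obtain n :: nat where "t \<le> real n" using real_arch_simple by blast
      then have "ennreal (g t) * indicator {0..} t \<le> f n t" by (auto simp: f_def indicator_def)
      then show "ennreal (g t) * indicator {0..} t \<le> (SUP n. f n t)" by (rule SUP_upper2[OF UNIV_I])
      show "(SUP n. f n t) \<le> ennreal (g t) * indicator {0..} t"
        by (rule SUP_least) (auto simp: f_def indicator_def)
    qed
  qed
  also have "\<dots> = (SUP n. \<integral>\<^sup>+ t. f n t \<partial>lborel)"
    by (rule nn_integral_monotone_convergence_SUP[OF \<open>incseq f\<close> f_meas])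
  also have "\<dots> \<le> ennreal c"
  proof (rule SUP_least)
    fix n :: nat
    have "(\<integral>\<^sup>+ t. f n t \<partial>lborel) = ennreal (LINT s:{0..real n}|lborel. g s)"
      unfolding f_eq set_lebesgue_integral_def
      by (rule nn_integral_eq_integral) (use int nonneg in \<open>auto simp: set_integrable_def\<close>)
    then show "(\<integral>\<^sup>+ t. f n t \<partial>lborel) \<le> ennreal c" using le[of n] by (simp add: ennreal_leI)
  qed
  finally show ?thesis .
qed

lemma mild_solution_diff:
  assumes sg: "c0_semigroup sc T" and z: "mild_solution T 0 f z" and y: "mild_solution T 0 g y"
  shows "mild_solution T 0 (\<lambda>s. f s - g s) (\<lambda>t. z t - y t)"
  unfolding mild_solution_def
proof (intro conjI allI impI)
  show "continuous_on {0..} (\<lambda>t. z t - y t)"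
    using z y unfolding mild_solution_def by (intro continuous_intros) auto
  fix t :: real assume t: "t \<ge> 0"
  have T0: "T t 0 = 0" by (rule linear_0[OF bounded_linear.linear[OF semigroup_linear[OF sg t]]])
  have int: "set_integrable lborel {0..t} (\<lambda>s. T (t - s) (f s))" "set_integrable lborel {0..t} (\<lambda>s. T (t - s) (g s))"
    and eq: "z t = (LINT s:{0..t}|lborel. T (t - s) (f s))" "y t = (LINT s:{0..t}|lborel. T (t - s) (g s))"
    using z y t T0 unfolding mild_solution_def by auto
  have diff: "T (t - s) (f s - g s) = T (t - s) (f s) - T (t - s) (g s)" if "s \<in> {0..t}" for s
    using linear_diff[OF bounded_linear.linear[OF semigroup_linear[OF sg]], of "t - s"] that by simp
  have "set_integrable lborel {0..t} (\<lambda>s. T (t - s) (f s - g s)) \<longleftrightarrow>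
      set_integrable lborel {0..t} (\<lambda>s. T (t - s) (f s) - T (t - s) (g s))"
    by (rule set_integrable_cong) (simp_all add: diff)
  then show "set_integrable lborel {0..t} (\<lambda>s. T (t - s) (f s - g s))"
    using set_integral_diff(1)[OF int] by simp
  have "(LINT s:{0..t}|lborel. T (t - s) (f s - g s)) = (LINT s:{0..t}|lborel. T (t - s) (f s) - T (t - s) (g s))"
    by (rule set_lebesgue_integral_cong) (simp_all add: diff)
  then show "z t - y t = T t 0 + (LINT s:{0..t}|lborel. T (t - s) (f s - g s))"
    using set_integral_diff(2)[OF int] by (simp add: T0 eq)
qed

text \<open>The difference of the state and of the observer state is a mild solution of the error
equation \<open>e' = A e + w + L (C e + S v)\<close>.\<close>

lemma estimation_error_le:
  fixes T :: "real \<Rightarrow> 'z::{real_inner,banach,second_countable_topology} \<Rightarrow> 'z"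
    and C :: "'z \<Rightarrow> 'y::{real_inner,banach,second_countable_topology}"
    and S :: "'v::{real_inner,banach,second_countable_topology} \<Rightarrow> 'y"
    and Q :: "'z \<Rightarrow> 'q::{real_inner,banach,second_countable_topology}"
  assumes sg: "c0_semigroup sc T" and gen: "infinitesimal_generator T D A"
    and sa: "self_adjoint D A" and neg: "strictly_negative D A"
    and Q: "bounded_linear Q" and C: "bounded_linear C" and S: "bounded_linear S"
    and P: "bounded_linear P" "\<And>x y. P x \<bullet> y = x \<bullet> P y" "\<And>y. S (adjoint S (P y)) = y"
    and \<gamma>: "\<gamma> \<ge> 0" "\<And>x. x \<in> D \<Longrightarrow> (norm (Q x))\<^sup>2 \<le> \<gamma> * ((norm (A x))\<^sup>2 + C x \<bullet> P (C x))"
  shows "estimation_error T Q C S (inv_into D A \<circ> adjoint C \<circ> P) \<le> ennreal (sqrt \<gamma>)"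
  unfolding estimation_error_def
proof (rule Sup_least, elim CollectE exE conjE)
  let ?L = "inv_into D A \<circ> adjoint C \<circ> P"
  fix n w v z y \<nu>
  assume n: "n = L2_norm (\<lambda>t. Q (z t) - Q (\<nu> t))"
    and w: "w \<in> L2" and v: "v \<in> L2" and wv: "(L2_norm w)\<^sup>2 + (L2_norm v)\<^sup>2 = 1"
    and z: "mild_solution T 0 w z" and y: "y = (\<lambda>t. C (z t) + S (v t))"
    and \<nu>: "mild_solution T 0 (\<lambda>t. ?L (C (\<nu> t) - y t)) \<nu>"
  define e where "e t = z t - \<nu> t" for t
  have L: "bounded_linear ?L"
    unfolding o_def
    by (intro bounded_linear_compose[OF strictly_negative_inverse(2)[OF sa neg]]
        bounded_linear_compose[OF bounded_linear_adjoint[OF C]] P)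
  have "w t - ?L (C (\<nu> t) - y t) = w t + ?L (C (e t) + S (v t))" for t
  proof -
    have "C (\<nu> t) - y t = - (C (e t) + S (v t))"
      unfolding y e_def by (simp add: linear_diff[OF bounded_linear.linear[OF C]])
    then show ?thesis using linear_neg[OF bounded_linear.linear[OF L], of "C (e t) + S (v t)"] by simp
  qed
  then have "(\<lambda>t. w t - ?L (C (\<nu> t) - y t)) = (\<lambda>t. w t + ?L (C (e t) + S (v t)))" by blast
  then have "mild_solution T 0 (\<lambda>t. w t + ?L (C (e t) + S (v t))) e"
    using mild_solution_diff[OF sg z \<nu>] unfolding e_def by (simp only:)
  then have mild: "mild_solution T 0 (\<lambda>s. w s + inv_into D A (adjoint C (P (C (e s) + S (v s))))) e"
    by (simp only: o_apply)
  have int: "integrable lborel (\<lambda>s. indicator {0..} s *\<^sub>R (norm (f s))\<^sup>2)"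
    "(L2_norm f)\<^sup>2 = ennreal (LINT s:{0..}|lborel. (norm (f s))\<^sup>2)"
    if f: "f \<in> L2" for f :: "real \<Rightarrow> 'x::{real_inner,banach,second_countable_topology}"
  proof -
    have m: "(\<lambda>s. indicator {0..} s *\<^sub>R f s) \<in> borel_measurable lborel"
      using f unfolding L2_def set_borel_measurable_def by blast
    have eq: "indicator {0..} s *\<^sub>R (norm (f s))\<^sup>2 = (norm (indicator {0..} s *\<^sub>R f s))\<^sup>2" for s
      by (auto simp: indicator_def)
    have nn: "(L2_norm f)\<^sup>2 = (\<integral>\<^sup>+s. ennreal (indicator {0..} s *\<^sub>R (norm (f s))\<^sup>2) \<partial>lborel)"
      unfolding L2_norm_power2 by (rule nn_integral_cong) (auto simp: indicator_def)
    have "L2_norm f < top" using f unfolding L2_def by simp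
    then have fin: "(L2_norm f)\<^sup>2 < top" by (simp add: power2_eq_square ennreal_mult_less_top)
    show "integrable lborel (\<lambda>s. indicator {0..} s *\<^sub>R (norm (f s))\<^sup>2)"
    proof (rule integrableI_nonneg)
      show "(\<lambda>s. indicator {0..} s *\<^sub>R (norm (f s))\<^sup>2) \<in> borel_measurable lborel"
        unfolding eq using m by measurable
      show "(\<integral>\<^sup>+ s. ennreal (indicator {0..} s *\<^sub>R (norm (f s))\<^sup>2) \<partial>lborel) < \<infinity>"
        using fin unfolding nn by simp
    qed simp
    then show "(L2_norm f)\<^sup>2 = ennreal (LINT s:{0..}|lborel. (norm (f s))\<^sup>2)"
      unfolding nn set_lebesgue_integral_def by (rule nn_integral_eq_integral) simp
  qed
  have sint: "set_integrable lborel {0..} (\<lambda>s. (norm (w s))\<^sup>2)" "set_integrable lborel {0..} (\<lambda>s. (norm (v s))\<^sup>2)"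
    using int(1) w v unfolding set_integrable_def by blast+
  let ?I = "\<lambda>X. LINT s:X|lborel. (norm (w s))\<^sup>2 + (norm (v s))\<^sup>2"
  have nn: "(LINT s:{0..}|lborel. (norm (f s))\<^sup>2) \<ge> 0" for f :: "real \<Rightarrow> 'x::real_normed_vector"
    unfolding set_lebesgue_integral_def by (rule integral_nonneg_AE) simp
  have I1: "?I {0..} = 1"
  proof -
    have "ennreal ((LINT s:{0..}|lborel. (norm (w s))\<^sup>2) + (LINT s:{0..}|lborel. (norm (v s))\<^sup>2)) = ennreal 1"
      using wv unfolding int(2)[OF w] int(2)[OF v] by (simp add: nn)
    then have "(LINT s:{0..}|lborel. (norm (w s))\<^sup>2) + (LINT s:{0..}|lborel. (norm (v s))\<^sup>2) = 1"
      using nn[of w] nn[of v] by (subst (asm) ennreal_inj) auto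
    then show ?thesis using set_integral_add(2)[OF sint] by simp
  qed
  have int_sum: "set_integrable lborel {0..} (\<lambda>s. (norm (w s))\<^sup>2 + (norm (v s))\<^sup>2)"
    by (rule set_integral_add(1)[OF sint])
  have bound: "(LINT s:{0..real n}|lborel. (norm (Q (e s)))\<^sup>2) \<le> \<gamma>" for n :: nat
  proof -
    have sub: "{0..real n} \<subseteq> {0..}" by auto
    have meas: "set_borel_measurable lborel {0..real n} w" "set_borel_measurable lborel {0..real n} v"
      using w v sub unfolding L2_def by (auto intro: set_borel_measurable_subset)
    have "(LINT s:{0..real n}|lborel. (norm (Q (e s)))\<^sup>2) \<le> \<gamma> * ?I {0..real n}"
      by (rule filter_bound[OF sg gen sa neg Q C S P \<gamma> mild _ meas(1) _ meas(2)])
         (auto intro: set_integrable_subset[OF sint(1)] set_integrable_subset[OF sint(2)])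
    also have "\<dots> \<le> \<gamma> * ?I {0..}"
    proof (rule mult_left_mono[OF _ \<gamma>(1)])
      show "?I {0..real n} \<le> ?I {0..}"
        unfolding set_lebesgue_integral_def
      proof (rule integral_mono)
        show "integrable lborel (\<lambda>s. indicator {0..real n} s *\<^sub>R ((norm (w s))\<^sup>2 + (norm (v s))\<^sup>2))"
          using set_integrable_subset[OF int_sum _ sub] unfolding set_integrable_def by simp
        show "integrable lborel (\<lambda>s. indicator {0..} s *\<^sub>R ((norm (w s))\<^sup>2 + (norm (v s))\<^sup>2))"
          using int_sum unfolding set_integrable_def .
      qed (auto simp: indicator_def)
    qed
    finally show ?thesis by (simp add: I1)
  qed
  have "continuous_on {0..} e" using mild unfolding mild_solution_def by blast
  then have "continuous_on {0..} (\<lambda>s. (norm (Q (e s)))\<^sup>2)"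
    by (intro continuous_intros bounded_linear.continuous_on[OF Q])
  then have "(\<integral>\<^sup>+ t\<in>{0..}. ennreal ((norm (Q (e t)))\<^sup>2) \<partial>lborel) \<le> ennreal \<gamma>"
    by (rule nn_integral_Ici_le) (use bound in auto)
  moreover have "Q (z t) - Q (\<nu> t) = Q (e t)" for t
    unfolding e_def by (simp add: linear_diff[OF bounded_linear.linear[OF Q]])
  ultimately have "n\<^sup>2 \<le> ennreal \<gamma>" unfolding n L2_norm_power2 by simp
  also have "ennreal \<gamma> = (ennreal (sqrt \<gamma>))\<^sup>2" using \<gamma>(1) by (simp add: ennreal_power)
  finally show "n \<le> ennreal (sqrt \<gamma>)" by (simp only: power2_le_iff_ennreal)
qed

section \<open>Undetectable disturbances\<close>

text \<open>The trajectory \<open>z t = t (N - t) x\<close> on \<open>[0, N]\<close>, continued by \<open>0\<close>, is produced by the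
disturbance \<open>w = z' - A z\<close>. For \<open>t \<ge> 0\<close> the factor is \<open>max 0 (t (N - t))\<close>, which is
continuous on the whole half line.\<close>

lemma mild_solution_bump:
  fixes T :: "real \<Rightarrow> 'z::{real_inner,banach,second_countable_topology} \<Rightarrow> 'z"
  assumes sg: "c0_semigroup sc T" and gen: "infinitesimal_generator T D A" and x: "x \<in> D" and N: "N > 0"
  defines "w \<equiv> \<lambda>t. if t \<le> N then (N - 2 * t) *\<^sub>R x - (t * (N - t)) *\<^sub>R A x else 0"
  shows "mild_solution T 0 w (\<lambda>t. max 0 (t * (N - t)) *\<^sub>R x)"
  unfolding mild_solution_def
proof (intro conjI allI impI)
  show "continuous_on {0..} (\<lambda>t. max 0 (t * (N - t)) *\<^sub>R x)" by (intro continuous_intros)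
  fix t :: real assume t: "t \<ge> 0"
  have T0: "T s 0 = 0" if "s \<ge> 0" for s
    by (rule linear_0[OF bounded_linear.linear[OF semigroup_linear[OF sg that]]])
  define b where "b = min t N"
  have b: "0 \<le> b" "b \<le> t" "b \<le> N" using t N unfolding b_def by auto
  define f where "f s = T (t - s) ((N - 2 * s) *\<^sub>R x - (s * (N - s)) *\<^sub>R A x)" for s
  have f_cont: "continuous_on {0..b} f"
    unfolding f_def
    by (rule semigroup_orbit_continuous_compose[OF sg]) (use b in \<open>auto intro!: continuous_intros\<close>)
  have f_int: "integrable lborel (\<lambda>s. indicator {0..b} s *\<^sub>R f s)"
    using borel_integrable_atLeastAtMost'[OF f_cont] unfolding set_integrable_def .
  have eq: "indicator {0..t} s *\<^sub>R T (t - s) (w s) = indicator {0..b} s *\<^sub>R f s" for s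
    using T0[of "t - s"] by (auto simp: w_def f_def b_def indicator_def)
  show "set_integrable lborel {0..t} (\<lambda>s. T (t - s) (w s))"
    unfolding set_integrable_def eq by (rule f_int)
  have "(LINT s:{0..b}|lborel. f s) = T (t - b) ((b * (N - b)) *\<^sub>R x) - T (t - 0) ((0 * (N - 0)) *\<^sub>R x)"
  proof (rule weak_FTC[OF b(1) f_cont])
    fix s y assume s: "s \<in> {0..b}"
    have ts: "t - s \<ge> 0" using s b by auto
    interpret Ts: bounded_linear "T (t - s)" by (rule semigroup_linear[OF sg ts])
    have "((\<lambda>r. T r x \<bullet> y) has_real_derivative T (t - s) (A x) \<bullet> y) (at (t - s) within (\<lambda>s. t - s) ` {0..b})"
      by (rule DERIV_subset[OF semigroup_has_derivative[OF sg gen ts x]]) (use b in auto)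
    moreover have "((\<lambda>s. t - s) has_real_derivative - 1) (at s within {0..b})"
      by (auto intro!: derivative_eq_intros)
    ultimately have "((\<lambda>r. T r x \<bullet> y) \<circ> (\<lambda>s. t - s) has_real_derivative (T (t - s) (A x) \<bullet> y) * (- 1))
        (at s within {0..b})" by (rule DERIV_image_chain)
    then have d: "((\<lambda>s. T (t - s) x \<bullet> y) has_real_derivative - (T (t - s) (A x) \<bullet> y)) (at s within {0..b})"
      by (simp add: o_def)
    have "((\<lambda>s. (s * (N - s)) * (T (t - s) x \<bullet> y)) has_real_derivative
        (N - 2 * s) * (T (t - s) x \<bullet> y) + - (T (t - s) (A x) \<bullet> y) * (s * (N - s))) (at s within {0..b})"
      by (rule DERIV_mult[OF _ d]) (auto intro!: derivative_eq_intros simp: algebra_simps)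
    moreover have "T (t - r) ((r * (N - r)) *\<^sub>R x) \<bullet> y = (r * (N - r)) * (T (t - r) x \<bullet> y)"
      if "r \<in> {0..b}" for r
    proof -
      interpret bounded_linear "T (t - r)" by (rule semigroup_linear[OF sg]) (use that b in auto)
      show ?thesis by (simp only: scale inner_scaleR_left)
    qed
    ultimately show "((\<lambda>s. T (t - s) ((s * (N - s)) *\<^sub>R x) \<bullet> y) has_real_derivative f s \<bullet> y) (at s within {0..b})"
      unfolding f_def
      by (subst has_field_derivative_cong_eventually[where g = "\<lambda>s. (s * (N - s)) * (T (t - s) x \<bullet> y)"])
         (use s in \<open>auto simp: eventually_at_filter Ts.diff Ts.scale inner_diff_left mult_ac\<close>)
  qed
  moreover have "T (t - b) ((b * (N - b)) *\<^sub>R x) = max 0 (t * (N - t)) *\<^sub>R x"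
  proof (cases "t \<le> N")
    case True
    then show ?thesis using t unfolding b_def by (simp add: semigroup_zero[OF sg] max_def)
  next
    case False
    then have "t * (N - t) \<le> 0" using t by (intro mult_nonneg_nonpos) auto
    then show ?thesis using False T0[of "t - N"] unfolding b_def by (simp add: max_def)
  qed
  ultimately show "max 0 (t * (N - t)) *\<^sub>R x = T t 0 + (LINT s:{0..t}|lborel. T (t - s) (w s))"
    using T0[OF t] unfolding set_lebesgue_integral_def eq by simp
qed

text \<open>If \<open>S p = C x\<close>, then the noise \<open>v = - \<phi> p\<close> cancels the measurement of the trajectory
\<open>z = \<phi> x\<close>, where \<open>\<phi> t = t (N - t)\<close> on \<open>[0, N]\<close>: the observer sees \<open>y = 0\<close> and stays
at \<open>0\<close>, whatever its gain. The two numbers \<open>N ^ 3 / 3\<close> and \<open>N ^ 5 / 30\<close> are the integrals of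
\<open>\<phi>'\<^sup>2\<close> and \<open>\<phi>\<^sup>2\<close>; the mixed term \<open>\<phi> \<phi>'\<close> integrates to \<open>0\<close>.\<close>

lemma estimation_error_ge_normalized:
  fixes T :: "real \<Rightarrow> 'z::{real_inner,banach,second_countable_topology} \<Rightarrow> 'z"
    and C :: "'z \<Rightarrow> 'y::{real_inner,banach,second_countable_topology}"
    and S :: "'v::{real_inner,banach,second_countable_topology} \<Rightarrow> 'y"
    and Q :: "'z \<Rightarrow> 'q::{real_inner,banach,second_countable_topology}"
  assumes sg: "c0_semigroup sc T" and gen: "infinitesimal_generator T D A"
    and Q: "bounded_linear Q" and C: "bounded_linear C" and S: "bounded_linear S" and L: "bounded_linear L"
    and x: "x \<in> D" and p: "S p = C x" and N: "N > 0"
    and norm1: "N ^ 3 / 3 * (norm x)\<^sup>2 + N ^ 5 / 30 * ((norm (A x))\<^sup>2 + (norm p)\<^sup>2) = 1"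
  shows "ennreal (N ^ 5 / 30 * (norm (Q x))\<^sup>2) \<le> (estimation_error T Q C S L)\<^sup>2"
proof -
  define \<phi> where "\<phi> t = (if t \<le> N then t * (N - t) else 0)" for t
  define w where "w t = (if t \<le> N then (N - 2 * t) *\<^sub>R x - (t * (N - t)) *\<^sub>R A x else 0)" for t
  define v where "v t = - (\<phi> t *\<^sub>R p)" for t
  define z where "z t = max 0 (t * (N - t)) *\<^sub>R x" for t
  have z_eq: "z t = \<phi> t *\<^sub>R x" if "t \<ge> 0" for t
    using that mult_nonneg_nonpos[of t "N - t"] by (auto simp: z_def \<phi>_def max_def)
  have lin0: "L 0 = 0" "C 0 = 0" "Q 0 = 0" by (intro linear_0 bounded_linear.linear L C Q)+
  have [measurable]: "\<phi> \<in> borel_measurable borel" "w \<in> borel_measurable borel"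
    unfolding \<phi>_def w_def by measurable
  have [measurable]: "v \<in> borel_measurable borel" unfolding v_def by measurable
  define a where "a = (norm (A x))\<^sup>2 + (norm p)\<^sup>2"
  define g where "g t = (N - 2 * t)\<^sup>2 * (norm x)\<^sup>2 - 2 * (N - 2 * t) * (t * (N - t)) * (x \<bullet> A x)
      + (t * (N - t))\<^sup>2 * a" for t
  have wv_g: "(norm (w t))\<^sup>2 + (norm (v t))\<^sup>2 = g t" if "t \<le> N" for t
    using that unfolding w_def v_def \<phi>_def g_def a_def power2_norm_eq_inner
    by (simp add: inner_diff inner_commute algebra_simps power2_eq_square)
  \<comment> \<open>an antiderivative of \<open>g\<close>\<close>
  define G where "G t = (N\<^sup>2 * t - 2 * N * t ^ 2 + 4 / 3 * t ^ 3) * (norm x)\<^sup>2 - (t * (N - t))\<^sup>2 * (x \<bullet> A x)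
      + (N\<^sup>2 * t ^ 3 / 3 - N * t ^ 4 / 2 + t ^ 5 / 5) * a" for t
  have G_deriv: "(G has_real_derivative g t) (at t)" for t
    unfolding G_def g_def
    by (auto intro!: derivative_eq_intros simp: algebra_simps power2_eq_square power3_eq_cube power4_eq_xxxx)
  have total: "(L2_norm w)\<^sup>2 + (L2_norm v)\<^sup>2 = 1"
  proof -
    have "(L2_norm w)\<^sup>2 + (L2_norm v)\<^sup>2
        = (\<integral>\<^sup>+ t. ennreal ((norm (w t))\<^sup>2) * indicator {0..} t + ennreal ((norm (v t))\<^sup>2) * indicator {0..} t \<partial>lborel)"
      unfolding L2_norm_power2 by (rule nn_integral_add[symmetric]) measurable
    also have "\<dots> = (\<integral>\<^sup>+ t. ennreal (g t) * indicator {0..N} t \<partial>lborel)"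
    proof (rule nn_integral_cong)
      fix t
      show "ennreal ((norm (w t))\<^sup>2) * indicator {0..} t + ennreal ((norm (v t))\<^sup>2) * indicator {0..} t
          = ennreal (g t) * indicator {0..N} t"
        using wv_g[of t] by (auto simp: indicator_def w_def v_def \<phi>_def simp flip: ennreal_plus)
    qed
    also have "\<dots> = ennreal (G N - G 0)"
    proof (rule nn_integral_FTC_Icc)
      show "g \<in> borel_measurable borel" unfolding g_def by measurable
      show "0 \<le> g t" if "t \<in> {0..N}" for t using wv_g[of t] that by (metis atLeastAtMost_iff sum_power2_ge_zero)
    qed (use G_deriv N in \<open>auto intro: has_field_derivative_at_within\<close>)
    also have "G N - G 0 = 1"
      using norm1 unfolding G_def a_def by (simp add: algebra_simps eval_nat_numeral)
    finally show ?thesis by simp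
  qed
  have fin: "L2_norm w < \<infinity>" "L2_norm v < \<infinity>"
  proof -
    have "L2_norm w \<noteq> top" "L2_norm v \<noteq> top" using total by (auto simp: power2_eq_square)
    then show "L2_norm w < \<infinity>" "L2_norm v < \<infinity>" by (simp_all add: less_top)
  qed
  have "w \<in> L2" "v \<in> L2" using fin unfolding L2_def set_borel_measurable_def by simp_all
  moreover have "mild_solution T 0 w z"
    using mild_solution_bump[OF sg gen x N] unfolding w_def z_def .
  moreover have "mild_solution T 0 (\<lambda>t. L (C 0 - (C (z t) + S (v t)))) (\<lambda>t. 0)"
    unfolding mild_solution_def
  proof (intro conjI allI impI)
    fix t :: real assume t: "t \<ge> 0"
    have T0: "T s 0 = 0" if "s \<ge> 0" for s
      by (rule linear_0[OF bounded_linear.linear[OF semigroup_linear[OF sg that]]])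
    have zero: "indicator {0..t} s *\<^sub>R T (t - s) (L (C 0 - (C (z s) + S (v s)))) = 0" for s
    proof (cases "s \<in> {0..t}")
      case True
      then have "C (z s) + S (v s) = 0"
        using z_eq[of s] p unfolding v_def
        by (simp add: linear_scale[OF bounded_linear.linear[OF C]] linear_scale[OF bounded_linear.linear[OF S]]
            linear_neg[OF bounded_linear.linear[OF S]])
      then show ?thesis using True T0[of "t - s"] by (simp add: lin0)
    qed simp
    show "set_integrable lborel {0..t} (\<lambda>s. T (t - s) (L (C 0 - (C (z s) + S (v s)))))"
      "0 = T t 0 + (LINT s:{0..t}|lborel. T (t - s) (L (C 0 - (C (z s) + S (v s)))))"
      unfolding set_integrable_def set_lebesgue_integral_def zero using T0[OF t] by simp_all
  qed simp
  ultimately have "L2_norm (\<lambda>t. Q (z t) - Q 0) \<le> estimation_error T Q C S L"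
    unfolding estimation_error_def using total by (intro Sup_upper CollectI exI conjI refl) auto
  then have "(L2_norm (\<lambda>t. Q (z t)))\<^sup>2 \<le> (estimation_error T Q C S L)\<^sup>2"
    by (simp add: lin0 power2_le_iff_ennreal)
  moreover have "(L2_norm (\<lambda>t. Q (z t)))\<^sup>2 = ennreal (N ^ 5 / 30 * (norm (Q x))\<^sup>2)"
  proof -
    define h where "h t = (t * (N - t))\<^sup>2 * (norm (Q x))\<^sup>2" for t
    define H where "H t = (N\<^sup>2 * t ^ 3 / 3 - N * t ^ 4 / 2 + t ^ 5 / 5) * (norm (Q x))\<^sup>2" for t
    have "(L2_norm (\<lambda>t. Q (z t)))\<^sup>2 = (\<integral>\<^sup>+ t. ennreal (h t) * indicator {0..N} t \<partial>lborel)"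
      unfolding L2_norm_power2
      by (rule nn_integral_cong)
         (auto simp: indicator_def z_eq \<phi>_def h_def lin0 linear_scale[OF bounded_linear.linear[OF Q]] power_mult_distrib)
    also have "\<dots> = ennreal (H N - H 0)"
    proof (rule nn_integral_FTC_Icc)
      show "h \<in> borel_measurable borel" unfolding h_def by measurable
      show "(H has_real_derivative h t) (at t)" for t
        unfolding H_def h_def
        by (auto intro!: derivative_eq_intros simp: algebra_simps power2_eq_square power3_eq_cube power4_eq_xxxx)
    qed (use N in \<open>auto simp: h_def\<close>)
    also have "H N - H 0 = N ^ 5 / 30 * (norm (Q x))\<^sup>2" unfolding H_def by (simp add: algebra_simps eval_nat_numeral)
    finally show ?thesis .
  qed
  ultimately show ?thesis by simp
qed

text \<open>The problem is homogeneous in \<open>x\<close>, so the normalization can be removed. As \<open>N\<close> grows, the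
contribution of \<open>\<phi>'\<close> becomes negligible against that of \<open>\<phi>\<close>.\<close>

lemma estimation_error_ge:
  fixes T :: "real \<Rightarrow> 'z::{real_inner,banach,second_countable_topology} \<Rightarrow> 'z"
    and C :: "'z \<Rightarrow> 'y::{real_inner,banach,second_countable_topology}"
    and S :: "'v::{real_inner,banach,second_countable_topology} \<Rightarrow> 'y"
    and Q :: "'z \<Rightarrow> 'q::{real_inner,banach,second_countable_topology}"
  assumes sg: "c0_semigroup sc T" and gen: "infinitesimal_generator T D A" and sa: "self_adjoint D A"
    and Q: "bounded_linear Q" and C: "bounded_linear C" and S: "bounded_linear S" and L: "bounded_linear L"
    and x: "x \<in> D" and p: "S p = C x"
    and r: "estimation_error T Q C S L = ennreal r" "r \<ge> 0"
  shows "(norm (Q x))\<^sup>2 \<le> r\<^sup>2 * ((norm (A x))\<^sup>2 + (norm p)\<^sup>2)"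
proof (cases "x = 0")
  case True
  then show ?thesis using linear_0[OF bounded_linear.linear[OF Q]] by simp
next
  case False
  let ?a = "(norm (A x))\<^sup>2 + (norm p)\<^sup>2"
  have le: "(norm (Q x))\<^sup>2 \<le> r\<^sup>2 * (10 * (norm x)\<^sup>2 / N\<^sup>2 + ?a)" if N: "N > 0" for N
  proof -
    define \<sigma> where "\<sigma> = N ^ 3 / 3 * (norm x)\<^sup>2 + N ^ 5 / 30 * ?a"
    have \<sigma>: "\<sigma> > 0" unfolding \<sigma>_def using N False by (intro add_pos_nonneg) auto
    define c where "c = 1 / sqrt \<sigma>"
    have c2: "c\<^sup>2 * \<sigma> = 1" using \<sigma> unfolding c_def by (simp add: power_divide)
    have "ennreal (N ^ 5 / 30 * (norm (Q (c *\<^sub>R x)))\<^sup>2) \<le> (estimation_error T Q C S L)\<^sup>2"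
    proof (rule estimation_error_ge_normalized[OF sg gen Q C S L])
      show "c *\<^sub>R x \<in> D" by (rule subspace_scale[OF self_adjoint_linear(1)[OF sa] x])
      show "S (c *\<^sub>R p) = C (c *\<^sub>R x)"
        by (simp add: linear_scale[OF bounded_linear.linear[OF C]] linear_scale[OF bounded_linear.linear[OF S]] p)
      show "N ^ 3 / 3 * (norm (c *\<^sub>R x))\<^sup>2 + N ^ 5 / 30 * ((norm (A (c *\<^sub>R x)))\<^sup>2 + (norm (c *\<^sub>R p))\<^sup>2) = 1"
        unfolding self_adjoint_scaleR[OF sa x] using c2 unfolding \<sigma>_def
        by (simp add: power_mult_distrib algebra_simps)
    qed (rule N)
    also have "\<dots> = ennreal (r\<^sup>2)" unfolding r(1) using r(2) by (simp add: ennreal_power)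
    finally have "N ^ 5 / 30 * (norm (Q (c *\<^sub>R x)))\<^sup>2 \<le> r\<^sup>2" by (simp add: ennreal_le_iff)
    then have "N ^ 5 / 30 * (c\<^sup>2 * (norm (Q x))\<^sup>2) * \<sigma> \<le> r\<^sup>2 * \<sigma>"
      using \<sigma> by (simp add: linear_scale[OF bounded_linear.linear[OF Q]] power_mult_distrib)
    moreover have "N ^ 5 / 30 * (c\<^sup>2 * (norm (Q x))\<^sup>2) * \<sigma> = N ^ 5 / 30 * (norm (Q x))\<^sup>2 * (c\<^sup>2 * \<sigma>)"
      by (simp only: mult_ac)
    ultimately have "N ^ 5 / 30 * (norm (Q x))\<^sup>2 \<le> r\<^sup>2 * \<sigma>" by (simp only: c2 mult_1_right)
    also have "\<sigma> = N ^ 5 / 30 * (10 * (norm x)\<^sup>2 / N\<^sup>2 + ?a)"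
      using N unfolding \<sigma>_def by (simp add: field_simps eval_nat_numeral)
    finally have "N ^ 5 / 30 * (norm (Q x))\<^sup>2 \<le> N ^ 5 / 30 * (r\<^sup>2 * (10 * (norm x)\<^sup>2 / N\<^sup>2 + ?a))"
      by (simp only: mult.left_commute)
    moreover have "N ^ 5 / 30 > 0" using N by simp
    ultimately show ?thesis by (simp only: mult_le_cancel_left_pos)
  qed
  have "((\<lambda>n. r\<^sup>2 * (10 * (norm x)\<^sup>2 / (real (Suc n))\<^sup>2 + ?a)) \<longlonglongrightarrow> r\<^sup>2 * (0 + ?a))"
  proof (intro tendsto_intros)
    have "(\<lambda>n. 10 * (norm x)\<^sup>2 * (1 / real (Suc n)) * (1 / real (Suc n))) \<longlonglongrightarrow> 10 * (norm x)\<^sup>2 * 0 * 0"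
      by (intro tendsto_intros LIMSEQ_inverse_real_of_nat[unfolded inverse_eq_divide])
    then show "(\<lambda>n. 10 * (norm x)\<^sup>2 / (real (Suc n))\<^sup>2) \<longlonglongrightarrow> 0"
      by (simp add: power2_eq_square)
  qed
  then have "(norm (Q x))\<^sup>2 \<le> r\<^sup>2 * (0 + ?a)"
    by (rule LIMSEQ_le_const) (use le in \<open>auto intro!: exI[of _ 0]\<close>)
  then show ?thesis by simp
qed

section \<open>The normal operator and the optimal gain\<close>

lemma hilbert_scalars_inner:
  assumes "hilbert_scalars sc"
  shows "sc a x \<bullet> sc a y = (norm a)\<^sup>2 * (x \<bullet> y)"
proof -
  interpret vector_space sc using assms unfolding hilbert_scalars_def by blast
  have n: "norm (sc a z) = norm a * norm z" for z using assms unfolding hilbert_scalars_def by blast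
  have polar: "x \<bullet> y = ((norm (x + y))\<^sup>2 - (norm x)\<^sup>2 - (norm y)\<^sup>2) / 2" for x y :: 'b
    by (simp add: power2_norm_eq_inner inner_add inner_commute)
  have "sc a x \<bullet> sc a y = ((norm a)\<^sup>2 * (norm (x + y))\<^sup>2 - (norm a)\<^sup>2 * (norm x)\<^sup>2 - (norm a)\<^sup>2 * (norm y)\<^sup>2) / 2"
    unfolding polar[of "sc a x"] scale_right_distrib[symmetric] n power_mult_distrib ..
  also have "\<dots> = (norm a)\<^sup>2 * (x \<bullet> y)" unfolding polar[of x y] by (simp add: algebra_simps)
  finally show ?thesis .
qed

text \<open>A scalar acts as a multiple of an isometry, so the adjoint with respect to the real inner
product of a \<open>'k\<close>-linear operator is \<open>'k\<close>-linear.\<close>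

lemma adjoint_bounded_ops:
  fixes B :: "'x::{real_inner,banach} \<Rightarrow> 'y::{real_inner,banach}"
  assumes X: "hilbert_scalars scX" and Y: "hilbert_scalars scY" and B: "B \<in> bounded_ops scX scY"
  shows "adjoint B \<in> bounded_ops scY scX"
proof -
  interpret X: vector_space scX using X unfolding hilbert_scalars_def by blast
  interpret Y: vector_space scY using Y unfolding hilbert_scalars_def by blast
  have lin: "bounded_linear B" and sc: "\<And>a x. B (scX a x) = scY a (B x)" using B unfolding bounded_ops_def by auto
  note adj = adjoint_inner[OF lin]
  have "adjoint B (scY a y) = scX a (adjoint B y)" for a y
  proof (cases "a = 0")
    case True
    then show ?thesis
      using linear_0[OF bounded_linear.linear[OF bounded_linear_adjoint[OF lin]]] by simp
  next
    case False
    have "x \<bullet> adjoint B (scY a y) = x \<bullet> scX a (adjoint B y)" for x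
    proof -
      define x' where "x' = scX (inverse a) x"
      have x: "x = scX a x'" using False unfolding x'_def by (simp add: X.scale_scale)
      have "x \<bullet> adjoint B (scY a y) = scY a (B x') \<bullet> scY a y" unfolding adj[symmetric] x sc ..
      also have "\<dots> = (norm a)\<^sup>2 * (x' \<bullet> adjoint B y)" unfolding hilbert_scalars_inner[OF Y] adj ..
      also have "\<dots> = x \<bullet> scX a (adjoint B y)" unfolding x hilbert_scalars_inner[OF X] ..
      finally show ?thesis .
    qed
    then show ?thesis using vector_eq_ldot by blast
  qed
  then show ?thesis using bounded_linear_adjoint[OF lin] unfolding bounded_ops_def by blast
qed

lemma generator_scalar:
  fixes T :: "real \<Rightarrow> 'z::{real_inner,banach} \<Rightarrow> 'z"
  assumes sc: "hilbert_scalars sc" and sg: "c0_semigroup sc T" and gen: "infinitesimal_generator T D A" and z: "z \<in> D"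
  shows "sc a z \<in> D" "A (sc a z) = sc a (A z)"
proof -
  interpret vector_space sc using sc unfolding hilbert_scalars_def by blast
  have n: "norm (sc a z) = norm a * norm z" for a z using sc unfolding hilbert_scalars_def by blast
  have re: "sc (of_real r) x = r *\<^sub>R x" for r x using sc unfolding hilbert_scalars_def by blast
  have comm: "sc a (r *\<^sub>R x) = r *\<^sub>R sc a x" for r x
    unfolding re[symmetric] by (simp add: scale_scale mult.commute)
  have lin: "bounded_linear (sc a)"
    by (rule bounded_linear_intro[where K = "norm a"])
       (simp_all add: scale_right_distrib comm n mult.commute)
  have "((\<lambda>h. (T h z - z) /\<^sub>R h) \<longlongrightarrow> A z) (at_right 0)"
    using gen z unfolding infinitesimal_generator_def by blast
  then have "((\<lambda>h. sc a ((T h z - z) /\<^sub>R h)) \<longlongrightarrow> sc a (A z)) (at_right 0)"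
    by (rule bounded_linear.tendsto[OF lin])
  moreover have "\<forall>\<^sub>F h in at_right 0. sc a ((T h z - z) /\<^sub>R h) = (T h (sc a z) - sc a z) /\<^sub>R h"
    using semigroup_scalar[OF sg] by (simp add: eventually_at_filter comm scale_right_diff_distrib)
  ultimately have lim: "((\<lambda>h. (T h (sc a z) - sc a z) /\<^sub>R h) \<longlongrightarrow> sc a (A z)) (at_right 0)"
    by (rule Lim_transform_eventually)
  then show "sc a z \<in> D" using gen unfolding infinitesimal_generator_def by blast
  then have "((\<lambda>h. (T h (sc a z) - sc a z) /\<^sub>R h) \<longlongrightarrow> A (sc a z)) (at_right 0)"
    using gen unfolding infinitesimal_generator_def by blast
  then show "A (sc a z) = sc a (A z)" using lim tendsto_unique trivial_limit_at_right_real by blast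
qed

text \<open>With \<open>B = A\<inverse>\<close> and \<open>N = C* P C\<close>, the equation \<open>A\<^sup>2 z + N z = f\<close> is equivalent to
\<open>(1 + B N B) u = B f\<close> and \<open>z = B u\<close>. The operator \<open>1 + B N B\<close> is bounded, self-adjoint and
bounded below by \<open>1\<close>.\<close>

lemma normal_operator_inverse:
  fixes A :: "'z::{real_inner,banach} \<Rightarrow> 'z" and C :: "'z \<Rightarrow> 'y::{real_inner,banach}"
  assumes sa: "self_adjoint D A" and neg: "strictly_negative D A" and C: "bounded_linear C"
    and P: "bounded_linear P" "\<And>x y. P x \<bullet> y = x \<bullet> P y" "\<And>y. P y \<bullet> y \<ge> 0"
  defines "W \<equiv> \<lambda>z. A (A z) + adjoint C (P (C z))" and "D2 \<equiv> {z \<in> D. A z \<in> D}"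
  shows "bij_betw W D2 UNIV" and "bounded_linear (inv_into D2 W)"
    and "inv_into D2 W f \<in> D2" and "W (inv_into D2 W f) = f"
proof -
  define B where "B = inv_into D A"
  note B = strictly_negative_inverse[OF sa neg, folded B_def]
  interpret B: bounded_linear B by (rule B(2))
  define N where "N z = adjoint C (P (C z))" for z
  have N_lin: "bounded_linear N"
    unfolding N_def by (intro bounded_linear_compose[OF bounded_linear_adjoint[OF C]] bounded_linear_compose[OF P(1)] C)
  have N_inner: "N x \<bullet> y = P (C x) \<bullet> C y" for x y
    unfolding N_def using adjoint_inner[OF C, of y "P (C x)"] by (simp add: inner_commute)
  have N_sym: "N x \<bullet> y = x \<bullet> N y" for x y
    using N_inner[of x y] N_inner[of y x] P(2)[of "C x" "C y"] by (simp add: inner_commute)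
  define X where "X u = u + B (N (B u))" for u
  have X_sa: "self_adjoint UNIV X"
  proof (rule self_adjoint_bounded)
    show "bounded_linear X"
      unfolding X_def
      by (intro bounded_linear_add bounded_linear_ident bounded_linear_compose[OF B(2)] bounded_linear_compose[OF N_lin] B(2))
    show "X x \<bullet> y = x \<bullet> X y" for x y
      unfolding X_def by (simp add: inner_add_left inner_add_right B(3) N_sym)
  qed
  have X_co: "X u \<bullet> u \<ge> 1 * (norm u)\<^sup>2" for u
    unfolding X_def using P(3)[of "C (B u)"] by (simp add: inner_add_left B(3) N_inner power2_norm_eq_inner)
  define U where "U = inv_into UNIV X"
  note U = coercive_self_adjoint_inverse[OF X_sa zero_less_one X_co, folded U_def]
  define V where "V f = B (U (B f))" for f
  \<comment> \<open>hence \<open>V f\<close> lies in the domain of \<open>A\<^sup>2\<close>\<close>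
  have U_in: "U (B f) \<in> D" for f
  proof -
    have "U (B f) = B (f - N (B (U (B f))))"
      using U(6)[of "B f"] unfolding X_def by (simp add: B.diff algebra_simps)
    then show ?thesis using B(4) by metis
  qed
  have V_in: "V f \<in> D2" for f unfolding V_def D2_def by (simp add: B(4,5) U_in)
  have WV: "W (V f) = f" for f
  proof -
    have "B (W (V f)) = U (B f) + B (N (V f))"
      unfolding W_def N_def[symmetric] by (simp add: B.add B(6) B(5) V_def U_in B(4))
    also have "\<dots> = B f" using U(6)[of "B f"] unfolding X_def V_def by simp
    finally show ?thesis using B(5) by metis
  qed
  have VW: "V (W z) = z" if z: "z \<in> D2" for z
  proof -
    have "z \<in> D" "A z \<in> D" using z unfolding D2_def by auto
    then have "B (W z) = X (A z)"
      unfolding W_def N_def[symmetric] X_def by (simp add: B.add B(6))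
    then show ?thesis using U(7)[of "A z"] B(6)[of z] \<open>z \<in> D\<close> unfolding V_def by simp
  qed
  have "bij_betw W D2 UNIV"
    by (rule bij_betw_byWitness[where f' = V]) (use V_in WV VW in auto)
  then show "bij_betw W D2 UNIV" .
  then have "inj_on W D2" by (rule bij_betw_imp_inj_on)
  then have inv: "inv_into D2 W = V"
    by (intro ext inv_into_f_eq V_in WV)
  show "inv_into D2 W f \<in> D2" "W (inv_into D2 W f) = f" unfolding inv by (rule V_in WV)+
  show "bounded_linear (inv_into D2 W)"
    unfolding inv V_def by (intro bounded_linear_compose[OF B(2)] bounded_linear_compose[OF U(2)] B(2))
qed

lemma normal_operator_form:
  fixes A :: "'z::{real_inner,banach} \<Rightarrow> 'z" and C :: "'z \<Rightarrow> 'y::{real_inner,banach}"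
  assumes sa: "self_adjoint D A" and C: "bounded_linear C"
    and x: "x \<in> D" and p: "p \<in> D" "A p \<in> D"
  shows "x \<bullet> (A (A p) + adjoint C (P (C p))) = A x \<bullet> A p + C x \<bullet> P (C p)"
  by (simp add: inner_add_right self_adjoint_sym[OF sa x p(2)] adjoint_inner[OF C])

text \<open>This is the Cauchy-Schwarz inequality for the form \<open>a x y = A x \<bullet> A y + C x \<bullet> P (C y)\<close> of
the normal operator \<open>W\<close>, applied to \<open>x\<close> and \<open>p = W\<inverse> (Q* (Q x))\<close>, since
\<open>a x p = \<parallel>Q x\<parallel>\<^sup>2\<close> and \<open>a p p \<le> \<parallel>Q W\<inverse> Q*\<parallel> \<parallel>Q x\<parallel>\<^sup>2\<close>. The factor \<open>\<tau>\<close> stays strictly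
above the norm, so that no division by \<open>0\<close> occurs when the norm vanishes.\<close>

lemma output_bound_by_form:
  fixes A :: "'z::{real_inner,banach} \<Rightarrow> 'z" and C :: "'z \<Rightarrow> 'y::{real_inner,banach}" and Q :: "'z \<Rightarrow> 'q::{real_inner,banach}"
  assumes sa: "self_adjoint D A" and neg: "strictly_negative D A" and C: "bounded_linear C" and Q: "bounded_linear Q"
    and P: "bounded_linear P" "\<And>x y. P x \<bullet> y = x \<bullet> P y" "\<And>y. P y \<bullet> y \<ge> 0"
  defines "W \<equiv> \<lambda>z. A (A z) + adjoint C (P (C z))"
  defines "G \<equiv> Q \<circ> inv_into {z \<in> D. A z \<in> D} W \<circ> adjoint Q"
  assumes x: "x \<in> D"
  shows "(norm (Q x))\<^sup>2 \<le> onorm G * ((norm (A x))\<^sup>2 + C x \<bullet> P (C x))"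
proof -
  define a where "a x y = A x \<bullet> A y + C x \<bullet> P (C y)" for x y
  define V where "V = inv_into {z \<in> D. A z \<in> D} W"
  note V = normal_operator_inverse[OF sa neg C P, folded W_def, folded V_def]
  have G: "bounded_linear G"
    unfolding G_def V_def[symmetric] o_def
    by (rule bounded_linear_compose[OF Q bounded_linear_compose[OF V(2) bounded_linear_adjoint[OF Q]]])
  have G_eq: "G h = Q (V (adjoint Q h))" for h unfolding G_def V_def by simp
  have \<gamma>0: "onorm G \<ge> 0" by (rule onorm_pos_le[OF G])
  define p where "p = V (adjoint Q (Q x))"
  have pD: "p \<in> D" "A p \<in> D" using V(3) unfolding p_def by auto
  have Wp: "W p = adjoint Q (Q x)" using V(4) unfolding p_def W_def by simp
  have ax: "a x p = (norm (Q x))\<^sup>2"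
    using normal_operator_form[OF sa C x pD, of P] adjoint_inner[OF Q, of x "Q x"] Wp
    unfolding a_def W_def by (simp add: power2_norm_eq_inner)
  have "a p p = G (Q x) \<bullet> Q x"
    using normal_operator_form[OF sa C pD(1) pD, of P] adjoint_inner[OF Q, of p "Q x"] Wp
    unfolding a_def W_def G_eq p_def by simp
  also have "\<dots> \<le> norm (G (Q x)) * norm (Q x)" by (rule norm_cauchy_schwarz)
  also have "\<dots> \<le> (onorm G * norm (Q x)) * norm (Q x)" by (intro mult_right_mono onorm[OF G]) simp
  finally have ap: "a p p \<le> onorm G * (norm (Q x))\<^sup>2" by (simp add: power2_eq_square)
  have pos: "a y y \<ge> 0" for y unfolding a_def using P(3)[of "C y"] by (simp add: inner_commute)
  have le: "(norm (Q x))\<^sup>2 \<le> \<tau> * a x x" if \<tau>: "\<tau> > onorm G" for \<tau>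
  proof -
    have \<tau>0: "\<tau> > 0" using \<tau> \<gamma>0 by simp
    have sub: "A (\<tau> *\<^sub>R x - p) = \<tau> *\<^sub>R A x - A p"
      using self_adjoint_add[OF sa subspace_scale[OF self_adjoint_linear(1)[OF sa] x]
          subspace_scale[OF self_adjoint_linear(1)[OF sa] pD(1)], of \<tau> "-1"]
        self_adjoint_scaleR[OF sa x] self_adjoint_scaleR[OF sa pD(1), of "-1"] by simp
    interpret C: bounded_linear C by (rule C)
    interpret P: bounded_linear P by (rule P)
    have "0 \<le> a (\<tau> *\<^sub>R x - p) (\<tau> *\<^sub>R x - p)" by (rule pos)
    also have "\<dots> = \<tau> * \<tau> * a x x - 2 * \<tau> * a x p + a p p"
      unfolding a_def sub C.diff C.scale P.diff P.scale inner_diff inner_scaleR_left inner_scaleR_right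
        inner_commute[of "A p" "A x"]
      using P(2)[of "C x" "C p"] by (simp add: inner_commute algebra_simps)
    also have "\<dots> \<le> \<tau> * \<tau> * a x x - 2 * \<tau> * a x p + \<tau> * (norm (Q x))\<^sup>2"
      using ap \<tau> mult_right_mono[of "onorm G" \<tau> "(norm (Q x))\<^sup>2"] by simp
    also have "\<dots> = \<tau> * (\<tau> * a x x - (norm (Q x))\<^sup>2)" unfolding ax by (simp add: algebra_simps)
    finally show ?thesis using \<tau>0 by (simp add: zero_le_mult_iff)
  qed
  have "(norm (Q x))\<^sup>2 \<le> onorm G * a x x"
  proof (rule field_le_epsilon)
    fix e :: real assume e: "e > 0"
    define d where "d = e / (a x x + 1)"
    have d: "d > 0" using e pos[of x] unfolding d_def by simp
    have "d * a x x \<le> e" using e pos[of x] unfolding d_def by (simp add: field_simps)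
    then show "(norm (Q x))\<^sup>2 \<le> onorm G * a x x + e" using le[of "onorm G + d"] d by (simp add: distrib_right)
  qed
  then show ?thesis unfolding a_def by (simp add: power2_norm_eq_inner)
qed

theorem theorem6:
  fixes scZ :: "'k::real_normed_field \<Rightarrow> 'z::{real_inner,banach,second_countable_topology} \<Rightarrow> 'z"
    and scQ :: "'k \<Rightarrow> 'q::{real_inner,banach,second_countable_topology} \<Rightarrow> 'q"
    and scY :: "'k \<Rightarrow> 'y::{real_inner,banach,second_countable_topology} \<Rightarrow> 'y"
    and scV :: "'k \<Rightarrow> 'v::{real_inner,banach,second_countable_topology} \<Rightarrow> 'v"
    and T :: "real \<Rightarrow> 'z \<Rightarrow> 'z" and D :: "'z set" and A :: "'z \<Rightarrow> 'z"
    and Q :: "'z \<Rightarrow> 'q" and C :: "'z \<Rightarrow> 'y" and S :: "'v \<Rightarrow> 'y"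
  assumes "hilbert_scalars scZ" "hilbert_scalars scQ" "hilbert_scalars scY" "hilbert_scalars scV"
    and "c0_semigroup scZ T" and "infinitesimal_generator T D A"
    and "Q \<in> bounded_ops scZ scQ" and "C \<in> bounded_ops scZ scY" and "S \<in> bounded_ops scV scY"
    and "strictly_positive UNIV (S \<circ> adjoint S)"
    and "self_adjoint D A" and "strictly_negative D A"
  shows
    "let R = S \<circ> adjoint S;
         L_opt = inv_into D A \<circ> adjoint C \<circ> inv R;
         W = (\<lambda>z. A (A z) + adjoint C (inv R (C z)));
         W_inv = inv_into {z \<in> D. A z \<in> D} W
     in bij R \<and> bij_betw A D UNIV \<and> bij_betw W {z \<in> D. A z \<in> D} UNIV \<and>
        bounded_linear (Q \<circ> W_inv \<circ> adjoint Q) \<and>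
        is_arg_min (estimation_error T Q C S) (\<lambda>L. L \<in> bounded_ops scY scZ) L_opt \<and>
        estimation_error T Q C S L_opt
          = ennreal (sqrt (onorm (Q \<circ> W_inv \<circ> adjoint Q)))"
proof -
  note sg = assms(5) and gen = assms(6) and sa = assms(11) and neg = assms(12)
  have Q: "bounded_linear Q" and C: "bounded_linear C" and S: "bounded_linear S"
    using assms(7-9) unfolding bounded_ops_def by auto
  define R where "R = S \<circ> adjoint S"
  define P where "P = inv R"
  obtain m where saR: "self_adjoint UNIV R" and m: "m > 0" "\<And>y. R y \<bullet> y \<ge> m * (norm y)\<^sup>2"
    using assms(10) unfolding strictly_positive_def R_def by blast
  note R = coercive_self_adjoint_inverse[OF saR m, folded P_def]
  have P: "bounded_linear P" "P x \<bullet> y = x \<bullet> P y" "S (adjoint S (P y)) = y" for x y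
    using R(2,3) R(6)[of y] unfolding R_def by simp_all
  have P_nonneg: "P y \<bullet> y \<ge> 0" and P_inner: "y \<bullet> P y = (norm (adjoint S (P y)))\<^sup>2" for y
    using adjoint_inner[OF S, of "adjoint S (P y)" "P y"] P(3)[of y]
    by (simp_all add: power2_norm_eq_inner inner_commute)
  define L_opt where "L_opt = inv_into D A \<circ> adjoint C \<circ> P"
  define W where "W z = A (A z) + adjoint C (P (C z))" for z
  define V where "V = inv_into {z \<in> D. A z \<in> D} W"
  note V = normal_operator_inverse[OF sa neg C P(1,2) P_nonneg, folded W_def, folded V_def]
  define G where "G = Q \<circ> V \<circ> adjoint Q"
  have G: "bounded_linear G"
    unfolding G_def o_def
    by (rule bounded_linear_compose[OF Q bounded_linear_compose[OF V(2) bounded_linear_adjoint[OF Q]]])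
  have \<gamma>0: "onorm G \<ge> 0" by (rule onorm_pos_le[OF G])
  have form: "(norm (Q x))\<^sup>2 \<le> onorm G * ((norm (A x))\<^sup>2 + C x \<bullet> P (C x))" if "x \<in> D" for x
    using output_bound_by_form[OF sa neg C Q P(1,2) P_nonneg that] unfolding G_def V_def W_def .
  have upper: "estimation_error T Q C S L_opt \<le> ennreal (sqrt (onorm G))"
    unfolding L_opt_def by (rule estimation_error_le[OF sg gen sa neg Q C S P \<gamma>0 form])
  have lower: "ennreal (sqrt (onorm G)) \<le> estimation_error T Q C S L" if L: "L \<in> bounded_ops scY scZ" for L
  proof (cases "estimation_error T Q C S L")
    case (real r)
    have Llin: "bounded_linear L" using L unfolding bounded_ops_def by blast
    have "norm (G h) \<le> r\<^sup>2 * norm h" for h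
    proof (cases "G h = 0")
      case False
      \<comment> \<open>for this \<open>x\<close>, the output is \<open>G h\<close> and the form of \<open>W\<close> takes the value \<open>G h \<bullet> h\<close>\<close>
      define x where "x = V (adjoint Q h)"
      have x: "x \<in> D" "A x \<in> D" using V(3) unfolding x_def by auto
      have "norm (A x) ^ 2 + norm (adjoint S (P (C x))) ^ 2 = x \<bullet> W x"
        using normal_operator_form[OF sa C x(1) x, of P] unfolding W_def P_inner[symmetric]
        by (simp add: power2_norm_eq_inner)
      also have "\<dots> = G h \<bullet> h"
        using V(4)[of "adjoint Q h"] adjoint_inner[OF Q, of x h] unfolding x_def G_def by simp
      also have "\<dots> \<le> norm (G h) * norm h" by (rule norm_cauchy_schwarz)
      finally have le: "norm (A x) ^ 2 + norm (adjoint S (P (C x))) ^ 2 \<le> norm (G h) * norm h" .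
      have "(norm (Q x))\<^sup>2 \<le> r\<^sup>2 * ((norm (A x))\<^sup>2 + (norm (adjoint S (P (C x))))\<^sup>2)"
        by (rule estimation_error_ge[OF sg gen sa Q C S Llin x(1) P(3)]) (use real in auto)
      also have "\<dots> \<le> r\<^sup>2 * (norm (G h) * norm h)" by (rule mult_left_mono[OF le]) simp
      finally have "norm (G h) * norm (G h) \<le> norm (G h) * (r\<^sup>2 * norm h)"
        unfolding x_def G_def by (simp add: power2_eq_square mult_ac)
      then show ?thesis using False by simp
    qed simp
    then have "onorm G \<le> r\<^sup>2" by (intro onorm_bound) simp_all
    then have "sqrt (onorm G) \<le> r" using real(1) by (intro real_le_lsqrt) auto
    then show ?thesis unfolding real(2) by (rule ennreal_leI)
  qed simp
  have L_opt: "L_opt \<in> bounded_ops scY scZ"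
  proof -
    note B = strictly_negative_inverse[OF sa neg]
    have adjC: "adjoint C (scY a y) = scZ a (adjoint C y)" and adjS: "adjoint S (scY a y) = scV a (adjoint S y)" for a y
      using adjoint_bounded_ops[OF assms(1,3,8)] adjoint_bounded_ops[OF assms(4,3,9)] unfolding bounded_ops_def by auto
    have Ssc: "S (scV a y) = scY a (S y)" for a y using assms(9) unfolding bounded_ops_def by blast
    have R_sc: "R (scY a y) = scY a (R y)" for a y unfolding R_def by (simp add: adjS Ssc)
    have "P (scY a y) = P (R (scY a (P y)))" for a y unfolding R_sc R(6) ..
    then have P_sc: "P (scY a y) = scY a (P y)" for a y by (simp add: R(7))
    have B_sc: "inv_into D A (scZ a z) = scZ a (inv_into D A z)" for a z
      using B(6)[OF generator_scalar(1)[OF assms(1) sg gen B(4)], of a z]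
        generator_scalar(2)[OF assms(1) sg gen B(4), of a z] by (simp add: B(5))
    have "bounded_linear L_opt"
      unfolding L_opt_def o_def
      by (intro bounded_linear_compose[OF B(2)] bounded_linear_compose[OF bounded_linear_adjoint[OF C]] P)
    then show ?thesis unfolding bounded_ops_def L_opt_def by (simp add: P_sc adjC B_sc)
  qed
  have eq: "estimation_error T Q C S L_opt = ennreal (sqrt (onorm G))"
    using upper lower[OF L_opt] by (rule antisym)
  moreover have "is_arg_min (estimation_error T Q C S) (\<lambda>L. L \<in> bounded_ops scY scZ) L_opt"
    unfolding is_arg_min_def eq using L_opt lower by (auto simp: not_less)
  ultimately show ?thesis
    using R(1) strictly_negative_inverse(1)[OF sa neg] V(1) G
    unfolding Let_def R_def[symmetric] P_def[symmetric] L_opt_def[symmetric] W_def[symmetric]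
      V_def[symmetric] G_def[symmetric] by blast
qed

end
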